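(* Let $t \geq 2$, let $H$ be a $t$-regular, nonbipartite graph and let $s \geq 3$. If $H \,\Box\, C_s$ has an extensible matching book embedding, then for every even integer $r>0$, $H \,\Box\, C_{s+r}$ also has an extensible matching book embedding which extends the given matching book embedding of $H \,\Box\, C_s$.
   Context: Graphs are finite and simple; $\Box$ denotes the Cartesian product of graphs; $C_n$ is the cycle with $n$ vertices, here with vertices $1,\dots,n$ in cyclic order (indices modulo $n$). Two distinct edges are adjacent if they share a vertex. A layout of a graph $G$ is a cyclic ordering (cyclic permutation) $\omega$ of its vertex set $V_G$, thought of as placing the vertices counterclockwise on a circle. Two edges conflict with respect to $\omega$ if their four endpoints occur in alternating order in $\omega$ (equivalently, the corresponding chords cross). A $k$-page matching book embedding is a triple $(G,\omega,c)$ where $\omega$ is a layout of $G$ and $c:E_G\to\{1,\dots,k\}$ is a surjection such that $c(e)\neq c(e')$ whenever $e$ and $e'$ are adjacent or conflict with respect to $\omega$. For $s \ge 3$ and $H$ a $t$-regular nonbipartite graph with $t \ge 2$, the block $H_j$ ($1\le j\le s$) of $H\,\Box\, C_s$ is the set of all vertices with second coordinate $j$; it induces a copy of $H$. A layout of $H\,\Box\, C_s$ is en bloc if (1) the vertices of each block occur consecutively in the layout and (2) the blocks occur in the natural counterclockwise order of the vertices of $C_s$; the order of the vertices inside a block may differ from block to block. The before-matching of the block $H_j$ is the set of $|V_H|$ edges of the product joining $H_{j-1}$ to $H_j$, and its after-matching is the set of $|V_H|$ edges joining $H_j$ to $H_{j+1}$. A matching book embedding of $H\,\Box\, C_s$ is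 extensible if its layout is en bloc, it has $t+3$ pages (colors), and there is some block (called a seed) such that: (a) the edges inside the block use only $t+1$ colors; and (b) the two colors unused inside the block are separated by the before- and after-matchings of the block, in the sense that neither of these two matchings contains edges of both unused colors. A matching book embedding of $H\,\Box\, C_{s+r}$ extends a given en bloc matching book embedding of $H\,\Box\, C_s$ if it is obtained by replacing some seed $H_j$ by $r+1$ consecutive blocks, leaving everything else unchanged, and with the first and last of these blocks identical to the seed. Precisely: for some $j$ such that $H_j$ is a seed, each block $i\le j$ of $H\,\Box\, C_s$ has the same order of its vertices and the same colors on its edges as block $i$ of $H\,\Box\, C_{s+r}$; each block $i\ge j$ has the same vertex order and edge colors as block $i+r$ of $H\,\Box\, C_{s+r}$ (vertices being identified by their first coordinate); for each $i<j$ the edges between blocks $i$ and $i+1$ have the same colors as the corresponding edges between blocks $i$ and $i+1$ of $H\,\Box\, C_{s+r}$; and for each $i$ with $j\le i\le s$ the edges between blocks $i$ and $i+1$ (block $s+1$ meaning block $1$) have the same colors as the corresponding edges between blocks $i+r$ and $i+r+1$ of $H\,\Box\, C_{s+r}$ (block $s+r+1$ meaning block $1$). *)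

theory Defs
  imports "HOL-Combinatorics.Orbits" "HOL-Combinatorics.Permutations"
begin

section \<open>Finite simple graphs\<close>

text \<open>A graph is a pair of a vertex set and a set of edges, the latter being two-element sets of
  vertices.\<close>

type_synonym 'v graph = "'v set \<times> 'v set set"

abbreviation verts :: "'v graph \<Rightarrow> 'v set" where "verts \<equiv> fst"
abbreviation edges :: "'v graph \<Rightarrow> 'v set set" where "edges \<equiv> snd"

definition simple_graph :: "'v graph \<Rightarrow> bool" where
  "simple_graph G \<longleftrightarrow> finite (verts G) \<and> (\<forall>e\<in>edges G. e \<subseteq> verts G \<and> card e = 2)"

definition regular :: "nat \<Rightarrow> 'v graph \<Rightarrow> bool" where
  "regular t G \<longleftrightarrow> (\<forall>v\<in>verts G. card {e \<in> edges G. v \<in> e} = t)"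

definition bipartite :: "'v graph \<Rightarrow> bool" where
  "bipartite G \<longleftrightarrow> (\<exists>X Y. X \<union> Y = verts G \<and> X \<inter> Y = {} \<and>
     (\<forall>e\<in>edges G. \<exists>x\<in>X. \<exists>y\<in>Y. e = {x, y}))"

definition cartesian_product :: "'a graph \<Rightarrow> 'b graph \<Rightarrow> ('a \<times> 'b) graph" where
  "cartesian_product G K =
     (verts G \<times> verts K,
      {{(u, x), (v, x)} | u v x. {u, v} \<in> edges G \<and> x \<in> verts K} \<union>
      {{(u, x), (u, y)} | u x y. u \<in> verts G \<and> {x, y} \<in> edges K})"

definition next_index :: "nat \<Rightarrow> nat \<Rightarrow> nat" where
  "next_index n i = (if i = n then 1 else i + 1)"

definition prev_index :: "nat \<Rightarrow> nat \<Rightarrow> nat" where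
  "prev_index n i = (if i = 1 then n else i - 1)"

definition cycle_graph :: "nat \<Rightarrow> nat graph" where
  "cycle_graph n = ({1..n}, {{i, next_index n i} | i. i \<in> {1..n}})"

abbreviation times_cycle :: "'a graph \<Rightarrow> nat \<Rightarrow> ('a \<times> nat) graph" where
  "times_cycle H s \<equiv> cartesian_product H (cycle_graph s)"


section \<open>Matching book embeddings\<close>

text \<open>A layout is a permutation of the vertex set consisting of a single cycle; it sends each
  vertex to the next one counterclockwise.\<close>

definition layout :: "'v graph \<Rightarrow> ('v \<Rightarrow> 'v) \<Rightarrow> bool" where
  "layout G \<omega> \<longleftrightarrow> \<omega> permutes verts G \<and> cyclic_on \<omega> (verts G)"

definition adjacent :: "'v set \<Rightarrow> 'v set \<Rightarrow> bool" where
  "adjacent e e' \<longleftrightarrow> e \<noteq> e' \<and> e \<inter> e' \<noteq> {}"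

text \<open>\<open>funpow_dist \<omega> a x\<close> is the number of counterclockwise steps from \<open>a\<close> to \<open>x\<close>, so the
  inequalities say that, starting at \<open>a\<close>, one meets \<open>u\<close>, then \<open>b\<close>, then \<open>v\<close>; in particular the
  four endpoints are distinct.\<close>

definition conflict :: "('v \<Rightarrow> 'v) \<Rightarrow> 'v set \<Rightarrow> 'v set \<Rightarrow> bool" where
  "conflict \<omega> e e' \<longleftrightarrow> (\<exists>a b u v. e = {a, b} \<and> e' = {u, v} \<and>
     0 < funpow_dist \<omega> a u \<and> funpow_dist \<omega> a u < funpow_dist \<omega> a b \<and>
     funpow_dist \<omega> a b < funpow_dist \<omega> a v)"

definition matching_book_embedding ::
    "nat \<Rightarrow> 'v graph \<Rightarrow> ('v \<Rightarrow> 'v) \<Rightarrow> ('v set \<Rightarrow> nat) \<Rightarrow> bool" where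
  "matching_book_embedding k G \<omega> c \<longleftrightarrow> layout G \<omega> \<and> c ` edges G = {1..k} \<and>
     (\<forall>e\<in>edges G. \<forall>e'\<in>edges G. adjacent e e' \<or> conflict \<omega> e e' \<longrightarrow> c e \<noteq> c e')"


section \<open>Blocks and en bloc layouts\<close>

definition block :: "'a graph \<Rightarrow> nat \<Rightarrow> ('a \<times> nat) set" where
  "block H j = verts H \<times> {j}"

definition block_edges :: "'a graph \<Rightarrow> nat \<Rightarrow> nat \<Rightarrow> ('a \<times> nat) set set" where
  "block_edges H s j = {e \<in> edges (times_cycle H s). e \<subseteq> block H j}"

definition joining_edges :: "'v graph \<Rightarrow> 'v set \<Rightarrow> 'v set \<Rightarrow> 'v set set" where
  "joining_edges G X Y = {e \<in> edges G. \<exists>x\<in>X. \<exists>y\<in>Y. e = {x, y}}"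

definition before_matching :: "'a graph \<Rightarrow> nat \<Rightarrow> nat \<Rightarrow> ('a \<times> nat) set set" where
  "before_matching H s j =
     joining_edges (times_cycle H s) (block H (prev_index s j)) (block H j)"

definition after_matching :: "'a graph \<Rightarrow> nat \<Rightarrow> nat \<Rightarrow> ('a \<times> nat) set set" where
  "after_matching H s j =
     joining_edges (times_cycle H s) (block H j) (block H (next_index s j))"

text \<open>The vertices of block \<open>j\<close> occur consecutively in the layout \<open>\<omega>\<close>, and \<open>xs\<close> lists their first
  coordinates in counterclockwise order. If there are at least two blocks, then \<open>xs\<close> is unique,
  since the whole layout is a single cycle.\<close>

definition block_order ::
    "'a graph \<Rightarrow> ('a \<times> nat \<Rightarrow> 'a \<times> nat) \<Rightarrow> nat \<Rightarrow> 'a list \<Rightarrow> bool" where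
  "block_order H \<omega> j xs \<longleftrightarrow> distinct xs \<and> set xs = verts H \<and>
     (\<forall>i. Suc i < length xs \<longrightarrow> \<omega> (xs ! i, j) = (xs ! Suc i, j))"

text \<open>The condition on \<open>last xs\<close> says that the vertex following the last one of block \<open>j\<close> lies in
  the next block (and hence is the first vertex of that block).\<close>

definition en_bloc :: "'a graph \<Rightarrow> nat \<Rightarrow> ('a \<times> nat \<Rightarrow> 'a \<times> nat) \<Rightarrow> bool" where
  "en_bloc H s \<omega> \<longleftrightarrow> (\<forall>j\<in>{1..s}. \<exists>xs. block_order H \<omega> j xs \<and>
     \<omega> (last xs, j) \<in> block H (next_index s j))"


section \<open>Extensible embeddings and extensions\<close>

definition seed ::
    "'a graph \<Rightarrow> nat \<Rightarrow> nat \<Rightarrow> (('a \<times> nat) set \<Rightarrow> nat) \<Rightarrow> nat \<Rightarrow> bool" where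
  "seed H t s c j \<longleftrightarrow> j \<in> {1..s} \<and> card (c ` block_edges H s j) = t + 1 \<and>
     (\<exists>a b. a \<noteq> b \<and> {1..t + 3} - c ` block_edges H s j = {a, b} \<and>
        \<not> {a, b} \<subseteq> c ` before_matching H s j \<and>
        \<not> {a, b} \<subseteq> c ` after_matching H s j)"

definition extensible ::
    "'a graph \<Rightarrow> nat \<Rightarrow> nat \<Rightarrow> ('a \<times> nat \<Rightarrow> 'a \<times> nat) \<Rightarrow> (('a \<times> nat) set \<Rightarrow> nat) \<Rightarrow> bool" where
  "extensible H t s \<omega> c \<longleftrightarrow> matching_book_embedding (t + 3) (times_cycle H s) \<omega> c \<and>
     en_bloc H s \<omega> \<and> (\<exists>j. seed H t s c j)"

definition same_block ::
    "'a graph \<Rightarrow> ('a \<times> nat \<Rightarrow> 'a \<times> nat) \<Rightarrow> (('a \<times> nat) set \<Rightarrow> nat) \<Rightarrow> nat \<Rightarrow>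
       ('a \<times> nat \<Rightarrow> 'a \<times> nat) \<Rightarrow> (('a \<times> nat) set \<Rightarrow> nat) \<Rightarrow> nat \<Rightarrow> bool" where
  "same_block H \<omega> c i \<omega>' c' i' \<longleftrightarrow>
     (\<exists>xs. block_order H \<omega> i xs \<and> block_order H \<omega>' i' xs) \<and>
     (\<forall>u v. {u, v} \<in> edges H \<longrightarrow> c {(u, i), (v, i)} = c' {(u, i'), (v, i')})"

text \<open>The embedding \<open>(\<omega>', c')\<close> of \<open>times_cycle H (s + r)\<close> extends the en bloc embedding
  \<open>(\<omega>, c)\<close> of \<open>times_cycle H s\<close>.\<close>

definition extends ::
    "'a graph \<Rightarrow> nat \<Rightarrow> nat \<Rightarrow> nat \<Rightarrow> ('a \<times> nat \<Rightarrow> 'a \<times> nat) \<Rightarrow> (('a \<times> nat) set \<Rightarrow> nat) \<Rightarrow>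
       ('a \<times> nat \<Rightarrow> 'a \<times> nat) \<Rightarrow> (('a \<times> nat) set \<Rightarrow> nat) \<Rightarrow> bool" where
  "extends H t s r \<omega>' c' \<omega> c \<longleftrightarrow> (\<exists>j. seed H t s c j \<and>
     (\<forall>i\<in>{1..j}. same_block H \<omega> c i \<omega>' c' i) \<and>
     (\<forall>i\<in>{j..s}. same_block H \<omega> c i \<omega>' c' (i + r)) \<and>
     (\<forall>i\<in>{1..<j}. \<forall>v\<in>verts H. c {(v, i), (v, i + 1)} = c' {(v, i), (v, i + 1)}) \<and>
     (\<forall>i\<in>{j..s}. \<forall>v\<in>verts H.
        c {(v, i), (v, next_index s i)} = c' {(v, i + r), (v, next_index (s + r) (i + r))}))"

end

theory Submission
  imports Defs
begin

text \<open>
  Fix a seed and let \<open>x\<close> and \<open>y\<close> be the two colors unused inside it. By condition (b) one of them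
  is missing from the before-matching and one is missing from the after-matching. The heart of
  the argument is that these two missing colors can be chosen distinct only because \<open>H\<close> is not
  bipartite: if one color \<open>z\<close> were missing both inside the seed and from both matchings, then the
  \<open>t + 2\<close> distinctly colored edges at each vertex of the seed would show all of the remaining
  \<open>t + 2\<close> colors. Take an edge \<open>e\<close> inside the seed and the vertices lying under it, that is, between
  its ends in the block order. Each of them meets an edge colored like \<open>e\<close>. That edge cannot
  cross \<open>e\<close>, so it stays inside the seed and both its ends lie under \<open>e\<close>. Hence the vertices under
  \<open>e\<close> are matched in pairs, the ends of \<open>e\<close> have positions of opposite parity, and \<open>H\<close> is
  bipartite (lemmas \<open>nested_edges_odd_span\<close> and \<open>bipartite_if_matchings_share_missing_color\<close>).

  So some unused color \<open>b\<close> is missing from the before-matching and the other unused color \<open>a\<close> is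
  missing from the after-matching. The seed is replaced by \<open>r + 1\<close> copies whose vertex orders are
  alternately the original order and its reverse. The \<open>r\<close> matchings between consecutive copies
  are then families of nested chords, so each of them may be given a single color: \<open>b\<close>, \<open>a\<close>,
  \<open>b\<close>, \<open>a\<close>, and so on. As \<open>r\<close> is even, the last copy has the original order and is entered by a
  matching of color \<open>a\<close>, which the old after-matching avoids; likewise the old before-matching
  avoids the color \<open>b\<close> leaving the first copy (lemma \<open>locally_proper_stretch\<close>). The first copy is
  again a seed, because the matching leaving it contains only the color \<open>b\<close>.

  The formal work lies in making \<open>conflict\<close> local. Numbering the vertices block by block, starting
  at any chosen block, turns the cyclic order into the order of the natural numbers; choosing the
  start near the edges under consideration ensures that none of them wraps around. This yields a
  characterization of proper colorings by conditions on two consecutive blocks each (lemma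
  \<open>proper_iff_locally_proper\<close>), and these conditions are easily transported from the old product
  to the new one.
\<close>

section \<open>Crossing chords and numberings of a cyclic order\<close>

text \<open>The crossing of chords for the linear order given by \<open>f\<close>. The roles of \<open>e\<close> and \<open>e'\<close> look
  different, but if one endpoint of \<open>e'\<close> is between those of \<open>e\<close> and the other one outside, then the
  same holds with \<open>e\<close> and \<open>e'\<close> exchanged.\<close>

definition crossing :: "('v \<Rightarrow> nat) \<Rightarrow> 'v set \<Rightarrow> 'v set \<Rightarrow> bool" where
  "crossing f e e' \<longleftrightarrow> (\<exists>a b u v. e = {a, b} \<and> e' = {u, v} \<and>
     f a < f u \<and> f u < f b \<and> (f v < f a \<or> f b < f v))"

lemma crossing_sym: "crossing f e e' \<longleftrightarrow> crossing f e' e"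
proof -
  have "crossing f e' e" if "crossing f e e'" for e e'
  proof -
    from that obtain a b u v where *: "e = {a, b}" "e' = {u, v}" "f a < f u" "f u < f b"
      "f v < f a \<or> f b < f v" unfolding crossing_def by blast
    from *(5) show ?thesis
    proof
      assume "f v < f a"
      with * show ?thesis unfolding crossing_def
        by (intro exI[of _ v] exI[of _ u] exI[of _ a] exI[of _ b]) auto
    next
      assume "f b < f v"
      with * show ?thesis unfolding crossing_def
        by (intro exI[of _ u] exI[of _ v] exI[of _ b] exI[of _ a]) auto
    qed
  qed
  then show ?thesis by blast
qed

text \<open>A numbering of \<open>V\<close> obtained by cutting the cycle \<open>\<omega>\<close> open at the vertex numbered \<open>0\<close>.\<close>

definition cyclic_ranking :: "'v set \<Rightarrow> ('v \<Rightarrow> 'v) \<Rightarrow> ('v \<Rightarrow> nat) \<Rightarrow> bool" where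
  "cyclic_ranking V \<omega> f \<longleftrightarrow> bij_betw f V {..<card V} \<and>
     (\<forall>x\<in>V. \<omega> x \<in> V \<and> f (\<omega> x) = Suc (f x) mod card V)"

lemma cyclic_ranking_less: "cyclic_ranking V \<omega> f \<Longrightarrow> x \<in> V \<Longrightarrow> f x < card V"
  unfolding cyclic_ranking_def using bij_betwE by fastforce

lemma cyclic_ranking_eq_iff:
  "cyclic_ranking V \<omega> f \<Longrightarrow> x \<in> V \<Longrightarrow> y \<in> V \<Longrightarrow> f x = f y \<longleftrightarrow> x = y"
  unfolding cyclic_ranking_def bij_betw_def inj_on_def by blast

lemma cyclic_ranking_funpow:
  assumes "cyclic_ranking V \<omega> f" "x \<in> V"
  shows "(\<omega> ^^ k) x \<in> V \<and> f ((\<omega> ^^ k) x) = (f x + k) mod card V"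
proof (induction k)
  case 0
  then show ?case using assms cyclic_ranking_less by fastforce
next
  case (Suc k)
  then show ?case using assms by (simp add: cyclic_ranking_def mod_Suc_eq)
qed

lemma funpow_dist_ranking:
  assumes r: "cyclic_ranking V \<omega> f" and x: "x \<in> V" and y: "y \<in> V"
  shows "funpow_dist \<omega> x y = (if f x \<le> f y then f y - f x else f y + card V - f x)"
    (is "_ = ?d")
  unfolding funpow_dist_def
proof (rule Least_equality)
  have lt: "f x < card V" "f y < card V"
    using assms cyclic_ranking_less by fast+
  have "f ((\<omega> ^^ ?d) x) = (f x + ?d) mod card V"
    using cyclic_ranking_funpow[OF r x] by blast
  also have "\<dots> = f y" using lt by auto
  finally show "(\<omega> ^^ ?d) x = y"
    using cyclic_ranking_funpow[OF r x] cyclic_ranking_eq_iff[OF r] y by blast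
  fix k assume "(\<omega> ^^ k) x = y"
  then have eq: "(f x + k) mod card V = f y"
    using cyclic_ranking_funpow[OF r x, of k] by simp
  show "?d \<le> k"
  proof (cases "f x + k < card V")
    case True
    then show ?thesis using eq by auto
  next
    case False
    show ?thesis
    proof (rule ccontr)
      assume "\<not> ?d \<le> k"
      with False lt have "f x + k - card V < f y" by (auto split: if_splits)
      moreover from this lt have "(f x + k - card V) mod card V = f x + k - card V" by simp
      ultimately show False using eq False by (simp add: mod_if)
    qed
  qed
qed

lemma cyclic_ranking_layout:
  assumes r: "cyclic_ranking (verts G) \<omega> f" and fin: "finite (verts G)" and ne: "verts G \<noteq> {}"
    and out: "\<And>x. x \<notin> verts G \<Longrightarrow> \<omega> x = x"
  shows "layout G \<omega>"
proof -
  let ?V = "verts G"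
  have reach: "y \<in> orbit \<omega> x" if "x \<in> ?V" "y \<in> ?V" for x y
  proof -
    \<comment> \<open>Going round once more than necessary, if need be, makes the number of steps positive.\<close>
    let ?k = "f y + card ?V - f x"
    have "f x < card ?V" "f y < card ?V" using r that cyclic_ranking_less by fast+
    then have "?k > 0" "(f x + ?k) mod card ?V = f y" by auto
    then have "(\<omega> ^^ ?k) x = y"
      using cyclic_ranking_funpow[OF r \<open>x \<in> ?V\<close>, of ?k] cyclic_ranking_eq_iff[OF r] that by auto
    with \<open>?k > 0\<close> have "\<exists>k. y = (\<omega> ^^ k) x \<and> 0 < k" by metis
    then show ?thesis unfolding orbit_altdef by (rule CollectI)
  qed
  have closed: "orbit \<omega> x \<subseteq> ?V" if "x \<in> ?V" for x
    using cyclic_ranking_funpow[OF r that] unfolding orbit_altdef by auto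
  obtain x where x: "x \<in> ?V" using ne by blast
  have cyc: "cyclic_on \<omega> ?V"
    unfolding cyclic_on_def using reach closed x by blast
  have "?V \<subseteq> \<omega> ` ?V"
  proof
    fix y assume y: "y \<in> ?V"
    then have "y \<in> orbit \<omega> y" using reach by blast
    then obtain k where "k > 0" "y = (\<omega> ^^ k) y" unfolding orbit_altdef by auto
    then have "y = \<omega> ((\<omega> ^^ (k - 1)) y)" by (cases k) auto
    then show "y \<in> \<omega> ` ?V" using cyclic_ranking_funpow[OF r y] by blast
  qed
  moreover have "\<omega> ` ?V \<subseteq> ?V" using r unfolding cyclic_ranking_def by blast
  ultimately have "bij_betw \<omega> ?V ?V"
    using fin by (simp add: bij_betw_def eq_card_imp_inj_on subset_antisym)
  then have "\<omega> permutes ?V" using out by (rule bij_imp_permutes)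
  with cyc show ?thesis unfolding layout_def by blast
qed

text \<open>Alternation of four points on a circle is invariant under rotation, so it can be read off after
  cutting the circle open anywhere. Counting from \<open>a\<close>, as \<open>conflict\<close> does, is just the cut at \<open>a\<close>.\<close>

lemma conflict_iff_crossing:
  assumes r: "cyclic_ranking V \<omega> f" and e: "e \<subseteq> V" "e' \<subseteq> V"
  shows "conflict \<omega> e e' \<longleftrightarrow> crossing f e e'"
proof
  note d = funpow_dist_ranking[OF r] and less = cyclic_ranking_less[OF r]
  assume "conflict \<omega> e e'"
  then obtain a b u v where *: "e = {a, b}" "e' = {u, v}" "0 < funpow_dist \<omega> a u"
    "funpow_dist \<omega> a u < funpow_dist \<omega> a b" "funpow_dist \<omega> a b < funpow_dist \<omega> a v"
    unfolding conflict_def by blast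
  with e have V: "a \<in> V" "b \<in> V" "u \<in> V" "v \<in> V" by auto
  \<comment> \<open>The four rotations of the cyclic order \<open>a, u, b, v\<close>; the last two need the names exchanged.\<close>
  have "f a < f u \<and> f u < f b \<and> (f v < f a \<or> f b < f v) \<or>
      f b < f v \<and> f v < f a \<and> (f u < f b \<or> f a < f u)"
    using *(3-5) less[OF V(1)] less[OF V(2)] less[OF V(3)] less[OF V(4)]
    unfolding d[OF V(1,2)] d[OF V(1,3)] d[OF V(1,4)] by (simp split: if_splits; linarith)
  then consider "f a < f u \<and> f u < f b \<and> (f v < f a \<or> f b < f v)"
    | "f b < f v \<and> f v < f a \<and> (f u < f b \<or> f a < f u)" by blast
  then show "crossing f e e'"
  proof cases
    case 1
    with * show ?thesis unfolding crossing_def by blast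
  next
    case 2
    moreover have "e = {b, a}" "e' = {v, u}" using * by auto
    ultimately show ?thesis unfolding crossing_def by blast
  qed
next
  note d = funpow_dist_ranking[OF r] and less = cyclic_ranking_less[OF r]
  assume "crossing f e e'"
  then obtain a b u v where *: "e = {a, b}" "e' = {u, v}" "f a < f u" "f u < f b"
      "f v < f a \<or> f b < f v" unfolding crossing_def by blast
  with e have V: "a \<in> V" "b \<in> V" "u \<in> V" "v \<in> V" by auto
  have "0 < funpow_dist \<omega> a u" "funpow_dist \<omega> a u < funpow_dist \<omega> a b"
    "funpow_dist \<omega> a b < funpow_dist \<omega> a v"
    using *(3-5) less[OF V(1)] less[OF V(2)] less[OF V(3)] less[OF V(4)] V
    by (auto simp: d split: if_splits)
  with * show "conflict \<omega> e e'" unfolding conflict_def by blast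
qed

section \<open>En bloc layouts\<close>

text \<open>The number of blocks passed when going from block \<open>z\<close> to block \<open>i\<close>. It is used for
  \<open>i\<close> and \<open>z\<close> in \<open>{1..s}\<close>, where the truncated subtraction is harmless.\<close>

definition offset :: "nat \<Rightarrow> nat \<Rightarrow> nat \<Rightarrow> nat" where
  "offset s z i = (i + s - z) mod s"

lemma next_index_in: "i \<in> {1..s} \<Longrightarrow> next_index s i \<in> {1..s}"
  by (auto simp: next_index_def)

lemma next_index_inj: "i \<in> {1..s} \<Longrightarrow> k \<in> {1..s} \<Longrightarrow> next_index s i = next_index s k \<longleftrightarrow> i = k"
  by (auto simp: next_index_def)

lemma next_index_neq: "2 \<le> s \<Longrightarrow> i \<in> {1..s} \<Longrightarrow> next_index s i \<noteq> i"
  by (auto simp: next_index_def)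

lemma next_next_index_neq: "3 \<le> s \<Longrightarrow> i \<in> {1..s} \<Longrightarrow> next_index s (next_index s i) \<noteq> i"
  by (auto simp: next_index_def)

lemma offset_next:
  assumes "i \<in> {1..s}" "z \<in> {1..s}"
  shows "offset s z (next_index s i) = Suc (offset s z i) mod s"
proof (cases "i = s")
  case True
  have "Suc (s + s - z) = Suc (s - z) + s" using assms by auto
  then have "Suc (s + s - z) mod s = Suc (s - z) mod s" by (metis mod_add_self2)
  then show ?thesis using True assms
    by (simp add: offset_def next_index_def mod_Suc_eq Suc_diff_le)
next
  case False
  then show ?thesis using assms
    by (simp add: offset_def next_index_def mod_Suc_eq Suc_diff_le)
qed

lemma offset_self [simp]: "offset s i i = 0"
  by (simp add: offset_def)

lemma offset_less: "0 < s \<Longrightarrow> offset s z i < s"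
  by (simp add: offset_def)

lemma offset_eq_iff:
  assumes "i \<in> {1..s}" "k \<in> {1..s}" "z \<in> {1..s}"
  shows "offset s z i = offset s z k \<longleftrightarrow> i = k"
proof -
  have "offset s z i = (if z \<le> i then i - z else i + s - z)" if "i \<in> {1..s}" for i
  proof (cases "z \<le> i")
    case True
    then have "(i + s - z) mod s = (i - z) mod s" by (metis Nat.add_diff_assoc2 mod_add_self2)
    moreover have "i - z < s" using that assms(3) by auto
    ultimately show ?thesis using True by (simp add: offset_def)
  qed (use that assms(3) in \<open>auto simp: offset_def\<close>)
  then show ?thesis using assms by (auto split: if_splits)
qed

text \<open>En bloc layouts in terms of positions: \<open>p i v\<close> is the place, counted from \<open>0\<close>, of the vertex \<open>v\<close>
  inside block \<open>i\<close>. Unlike the lists in \<open>block_order\<close>, positions can be compared directly and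
  reversed by subtraction. The definition singles out no first block.\<close>

definition arranged ::
    "'a graph \<Rightarrow> nat \<Rightarrow> (nat \<Rightarrow> 'a \<Rightarrow> nat) \<Rightarrow> ('a \<times> nat \<Rightarrow> 'a \<times> nat) \<Rightarrow> bool" where
  "arranged H s p \<omega> \<longleftrightarrow>
     (\<forall>i\<in>{1..s}. bij_betw (p i) (verts H) {..<card (verts H)}) \<and>
     (\<forall>i\<in>{1..s}. \<forall>v\<in>verts H. \<exists>w\<in>verts H.
        if Suc (p i v) < card (verts H) then \<omega> (v, i) = (w, i) \<and> p i w = Suc (p i v)
        else \<omega> (v, i) = (w, next_index s i) \<and> p (next_index s i) w = 0)"

text \<open>The place of a vertex in the whole layout, counted from the first vertex of block \<open>z\<close>. The
  starting block is a parameter so that it can be moved next to the edges under consideration.\<close>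

definition rank_from ::
    "'a graph \<Rightarrow> nat \<Rightarrow> (nat \<Rightarrow> 'a \<Rightarrow> nat) \<Rightarrow> nat \<Rightarrow> 'a \<times> nat \<Rightarrow> nat" where
  "rank_from H s p z x = offset s z (snd x) * card (verts H) + p (snd x) (fst x)"

text \<open>Everything about ranks is derived from this: their order is the lexicographic order of block
  offset and position.\<close>

lemma rank_from_less_iff:
  assumes "p i v < card (verts H)" "p k w < card (verts H)"
  shows "rank_from H s p z (v, i) < rank_from H s p z (w, k) \<longleftrightarrow>
    offset s z i < offset s z k \<or> offset s z i = offset s z k \<and> p i v < p k w"
proof -
  have *: "a * n + x < b * n + y" if "a < b" "x < n" for a b n x y :: nat
  proof -
    have "a * n + x < Suc a * n" using that by simp
    also have "\<dots> \<le> b * n" using that by (intro mult_le_mono1) simp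
    finally show ?thesis by simp
  qed
  show ?thesis
    using *[of "offset s z i" "offset s z k"] *[of "offset s z k" "offset s z i"] assms
    by (cases "offset s z i" "offset s z k" rule: linorder_cases)
      (auto simp: rank_from_def dest: less_asym)
qed

lemma verts_times_cycle: "verts (times_cycle H s) = verts H \<times> {1..s}"
  by (simp add: cartesian_product_def cycle_graph_def)

lemma arranged_position_less:
  "arranged H s p \<omega> \<Longrightarrow> i \<in> {1..s} \<Longrightarrow> v \<in> verts H \<Longrightarrow> p i v < card (verts H)"
  unfolding arranged_def using bij_betwE by fastforce

lemma arranged_position_eq_iff:
  "arranged H s p \<omega> \<Longrightarrow> i \<in> {1..s} \<Longrightarrow> v \<in> verts H \<Longrightarrow> w \<in> verts H \<Longrightarrow> p i v = p i w \<longleftrightarrow> v = w"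
  unfolding arranged_def bij_betw_def inj_on_def by blast

lemma rank_from_bij:
  assumes bij: "\<And>i. i \<in> {1..s} \<Longrightarrow> bij_betw (p i) (verts H) {..<card (verts H)}"
    and z: "z \<in> {1..s}"
  shows "bij_betw (rank_from H s p z) (verts H \<times> {1..s}) {..<card (verts H \<times> {1..s})}"
proof -
  let ?n = "card (verts H)"
  have less: "p i v < ?n" if "i \<in> {1..s}" "v \<in> verts H" for i v
    using bij[OF that(1)] that(2) bij_betwE by fastforce
  have inj: "inj_on (rank_from H s p z) (verts H \<times> {1..s})"
  proof (rule inj_onI, clarify)
    fix v i w k
    assume *: "v \<in> verts H" "i \<in> {1..s}" "w \<in> verts H" "k \<in> {1..s}"
      "rank_from H s p z (v, i) = rank_from H s p z (w, k)"
    note pl = less[OF *(2,1)] less[OF *(4,3)]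
    from *(5) rank_from_less_iff[where p = p, OF pl, of s z]
      rank_from_less_iff[where p = p, OF pl(2,1), of s z]
    have "offset s z i = offset s z k" "p i v = p k w" by auto
    moreover from this have "i = k" using offset_eq_iff * z by blast
    ultimately show "v = w \<and> i = k"
      using bij[OF \<open>i \<in> _\<close>] * by (auto simp: bij_betw_def inj_on_def)
  qed
  have "rank_from H s p z (v, i) < ?n * s" if "v \<in> verts H" "i \<in> {1..s}" for v i
  proof -
    have "rank_from H s p z (v, i) < Suc (offset s z i) * ?n"
      using less[OF that(2,1)] by (simp add: rank_from_def)
    also have "\<dots> \<le> s * ?n"
      using z by (intro mult_le_mono1) (simp add: offset_less Suc_leI)
    finally show ?thesis by (simp add: mult.commute)
  qed
  then have "rank_from H s p z ` (verts H \<times> {1..s}) \<subseteq> {..<?n * s}" by auto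
  moreover have "card (rank_from H s p z ` (verts H \<times> {1..s})) = ?n * s"
    using card_image[OF inj] by (simp add: card_cartesian_product)
  ultimately have "rank_from H s p z ` (verts H \<times> {1..s}) = {..<?n * s}"
    by (intro card_subset_eq) auto
  with inj show ?thesis by (simp add: bij_betw_def card_cartesian_product)
qed

lemma arranged_cyclic_ranking:
  assumes ar: "arranged H s p \<omega>" and z: "z \<in> {1..s}"
  shows "cyclic_ranking (verts (times_cycle H s)) \<omega> (rank_from H s p z)"
proof -
  let ?n = "card (verts H)" and ?r = "rank_from H s p z"
  have bij: "bij_betw ?r (verts H \<times> {1..s}) {..<card (verts H \<times> {1..s})}"
    using ar z unfolding arranged_def by (intro rank_from_bij) auto
  have "\<omega> (v, i) \<in> verts H \<times> {1..s} \<and> ?r (\<omega> (v, i)) = Suc (?r (v, i)) mod (?n * s)"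
    if v: "v \<in> verts H" and i: "i \<in> {1..s}" for v i
  proof (cases "Suc (p i v) < ?n")
    case True
    with ar v i obtain w where w: "w \<in> verts H" "\<omega> (v, i) = (w, i)" "p i w = Suc (p i v)"
      unfolding arranged_def by (metis (no_types, lifting))
    then have "?r (\<omega> (v, i)) = Suc (?r (v, i))" by (simp add: rank_from_def)
    moreover have "?r (w, i) < ?n * s"
      using bij_betwE[OF bij] w(1) i by (auto simp: card_cartesian_product)
    ultimately show ?thesis using w i by simp
  next
    case False
    with ar v i obtain w where w: "w \<in> verts H" "\<omega> (v, i) = (w, next_index s i)"
        "p (next_index s i) w = 0"
      unfolding arranged_def by (metis (no_types, lifting))
    have "Suc (p i v) = ?n" using False arranged_position_less[OF ar i v] by simp
    then have "Suc (?r (v, i)) = ?n * Suc (offset s z i)" by (simp add: rank_from_def)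
    then have "Suc (?r (v, i)) mod (?n * s) = ?n * (Suc (offset s z i) mod s)"
      by (metis mult_mod_right)
    then show ?thesis using w offset_next[OF i z] next_index_in[OF i]
      by (simp add: rank_from_def)
  qed
  with bij show ?thesis
    unfolding cyclic_ranking_def verts_times_cycle by (auto simp: card_cartesian_product)
qed

text \<open>The definition of \<open>en_bloc\<close> only says that the successor of the last vertex of a block lies
  somewhere in the next block. It is the first vertex there, since all the others already have a
  predecessor in their own block and \<open>\<omega>\<close> is injective.\<close>

lemma en_bloc_imp_arranged:
  assumes lay: "layout (times_cycle H s) \<omega>" and eb: "en_bloc H s \<omega>" and s: "2 \<le> s"
  obtains p where "arranged H s p \<omega>"
proof -
  obtain xs where xs: "\<And>i. i \<in> {1..s} \<Longrightarrow> block_order H \<omega> i (xs i)"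
    "\<And>i. i \<in> {1..s} \<Longrightarrow> \<omega> (last (xs i), i) \<in> block H (next_index s i)"
    using eb unfolding en_bloc_def by metis
  let ?n = "card (verts H)"
  define p where "p i = inv_into {..<?n} ((!) (xs i))" for i
  have len: "length (xs i) = ?n" if "i \<in> {1..s}" for i
    using xs(1)[OF that] distinct_card unfolding block_order_def by fastforce
  have nth: "bij_betw ((!) (xs i)) {..<?n} (verts H)" if "i \<in> {1..s}" for i
    using xs(1)[OF that] len[OF that] by (auto simp: block_order_def intro: bij_betw_nth)
  have bij: "bij_betw (p i) (verts H) {..<?n}" if "i \<in> {1..s}" for i
    unfolding p_def by (rule bij_betw_inv_into[OF nth[OF that]])
  have p_nth: "p i (xs i ! m) = m" if "i \<in> {1..s}" "m < ?n" for i m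
    unfolding p_def using bij_betw_inv_into_left[OF nth[OF that(1)]] that(2) by simp
  have nth_p: "xs i ! p i v = v" if "i \<in> {1..s}" "v \<in> verts H" for i v
    unfolding p_def using bij_betw_inv_into_right[OF nth[OF that(1)]] that(2) by simp
  have p_less: "p i v < ?n" if "i \<in> {1..s}" "v \<in> verts H" for i v
    using bij[OF that(1)] that(2) bij_betwE by fastforce
  have inside: "xs i ! m \<in> verts H" if "i \<in> {1..s}" "m < ?n" for i m
    using nth[OF that(1)] that(2) bij_betwE by fastforce
  have inj: "inj \<omega>" using lay unfolding layout_def by (blast intro: permutes_inj)
  have step: "\<omega> (v, i) = (xs i ! Suc (p i v), i)"
    if "i \<in> {1..s}" "v \<in> verts H" "Suc (p i v) < ?n" for i v
    using xs(1)[OF that(1)] len[OF that(1)] nth_p[OF that(1,2)] that(3)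
    unfolding block_order_def by metis
  have "arranged H s p \<omega>" unfolding arranged_def
  proof (intro conjI ballI)
    fix i v assume i: "i \<in> {1..s}" and v: "v \<in> verts H"
    show "\<exists>w\<in>verts H. if Suc (p i v) < ?n then \<omega> (v, i) = (w, i) \<and> p i w = Suc (p i v)
        else \<omega> (v, i) = (w, next_index s i) \<and> p (next_index s i) w = 0"
    proof (cases "Suc (p i v) < ?n")
      case True
      then show ?thesis using step[OF i v] inside[OF i True] p_nth[OF i True] by auto
    next
      case False
      let ?k = "next_index s i"
      have k: "?k \<in> {1..s}" by (rule next_index_in[OF i])
      have "p i v = ?n - 1" "xs i \<noteq> []" using False p_less[OF i v] len[OF i] by auto
      then have "last (xs i) = v" using nth_p[OF i v] len[OF i] by (simp add: last_conv_nth)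
      then obtain w where w: "w \<in> verts H" "\<omega> (v, i) = (w, ?k)"
        using xs(2)[OF i] by (auto simp: block_def)
      \<comment> \<open>If \<open>w\<close> were not first in its block, its predecessor there would be a second preimage of it.\<close>
      have "p ?k w = 0"
      proof (rule ccontr)
        assume "p ?k w \<noteq> 0"
        then obtain m where m: "p ?k w = Suc m" using not0_implies_Suc by blast
        let ?u = "xs ?k ! m"
        have m_less: "m < ?n" "Suc m < ?n" using m p_less[OF k w(1)] by auto
        then have "\<omega> (?u, ?k) = (xs ?k ! Suc m, ?k)"
          using step[OF k inside[OF k m_less(1)]] p_nth[OF k] by simp
        also have "\<dots> = \<omega> (v, i)" using nth_p[OF k w(1)] m w(2) by simp
        finally have "?k = i" using inj by (auto dest: injD)
        then show False using next_index_neq[OF s i] by simp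
      qed
      with w False show ?thesis by auto
    qed
  qed (use bij in auto)
  then show thesis by (rule that)
qed

text \<open>Conversely, any choice of vertex orders inside the blocks is realized by a layout.\<close>

lemma arranged_ex:
  assumes bij: "\<And>i. i \<in> {1..s} \<Longrightarrow> bij_betw (p i) (verts H) {..<card (verts H)}"
    and fin: "finite (verts H)" and ne: "verts H \<noteq> {}" and s: "0 < s"
  obtains \<omega> where "arranged H s p \<omega>" "layout (times_cycle H s) \<omega>"
proof -
  let ?n = "card (verts H)"
  define at where "at i m = inv_into (verts H) (p i) m" for i m
  define \<omega> where "\<omega> x = (if x \<in> verts H \<times> {1..s} then
      if Suc (p (snd x) (fst x)) < ?n then (at (snd x) (Suc (p (snd x) (fst x))), snd x)
      else (at (next_index s (snd x)) 0, next_index s (snd x)) else x)" for x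
  have at: "at i m \<in> verts H" "p i (at i m) = m" if "i \<in> {1..s}" "m < ?n" for i m
    using bij[OF that(1)] that(2) unfolding at_def bij_betw_def
    by (auto simp: inv_into_into f_inv_into_f)
  have n: "0 < ?n" using fin ne by (simp add: card_gt_0_iff)
  have ar: "arranged H s p \<omega>"
    unfolding arranged_def
  proof (intro conjI ballI)
    fix i v assume i: "i \<in> {1..s}" and v: "v \<in> verts H"
    show "\<exists>w\<in>verts H. if Suc (p i v) < ?n then \<omega> (v, i) = (w, i) \<and> p i w = Suc (p i v)
        else \<omega> (v, i) = (w, next_index s i) \<and> p (next_index s i) w = 0"
      using at[OF i, of "Suc (p i v)"] at[OF next_index_in[OF i] n] i v
      by (cases "Suc (p i v) < ?n") (auto simp: \<omega>_def)
  qed (use bij in auto)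
  have "cyclic_ranking (verts (times_cycle H s)) \<omega> (rank_from H s p 1)"
    using s by (intro arranged_cyclic_ranking[OF ar]) auto
  then have "layout (times_cycle H s) \<omega>"
    using fin ne s by (rule_tac cyclic_ranking_layout) (auto simp: verts_times_cycle \<omega>_def)
  with ar show thesis by (rule that)
qed

definition vertex_list :: "'a set \<Rightarrow> ('a \<Rightarrow> nat) \<Rightarrow> 'a list" where
  "vertex_list V f = map (inv_into V f) [0..<card V]"

lemma arranged_block_order:
  assumes ar: "arranged H s p \<omega>" and i: "i \<in> {1..s}"
  shows "block_order H \<omega> i (vertex_list (verts H) (p i))"
proof -
  let ?n = "card (verts H)" and ?g = "inv_into (verts H) (p i)"
  have bij: "bij_betw (p i) (verts H) {..<?n}" using ar i unfolding arranged_def by blast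
  have g: "bij_betw ?g {..<?n} (verts H)" by (rule bij_betw_inv_into[OF bij])
  have "\<omega> (?g m, i) = (?g (Suc m), i)" if m: "Suc m < ?n" for m
  proof -
    have "?g m \<in> verts H" "p i (?g m) = m"
      using m bij_betwE[OF g] bij_betw_inv_into_right[OF bij] by auto
    with ar i m obtain w where "w \<in> verts H" "\<omega> (?g m, i) = (w, i)" "p i w = Suc m"
      unfolding arranged_def by (metis (no_types, lifting))
    then show ?thesis using bij_betw_inv_into_left[OF bij] by metis
  qed
  with g show ?thesis
    by (auto simp: block_order_def vertex_list_def distinct_map bij_betw_def lessThan_atLeast0)
qed

lemma arranged_imp_en_bloc:
  assumes ar: "arranged H s p \<omega>" and fin: "finite (verts H)" and ne: "verts H \<noteq> {}"
  shows "en_bloc H s \<omega>"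
  unfolding en_bloc_def
proof (intro ballI exI conjI)
  fix i assume i: "i \<in> {1..s}"
  let ?n = "card (verts H)" and ?g = "inv_into (verts H) (p i)"
  show "block_order H \<omega> i (vertex_list (verts H) (p i))" by (rule arranged_block_order[OF ar i])
  have bij: "bij_betw (p i) (verts H) {..<?n}" using ar i unfolding arranged_def by blast
  have n: "0 < ?n" using fin ne by (simp add: card_gt_0_iff)
  then have "last (vertex_list (verts H) (p i)) = ?g (?n - 1)"
    by (simp add: vertex_list_def last_map)
  moreover have "?g (?n - 1) \<in> verts H" "p i (?g (?n - 1)) = ?n - 1"
    using n bij_betwE[OF bij_betw_inv_into[OF bij]] bij_betw_inv_into_right[OF bij] by auto
  moreover from this n have "\<not> Suc (p i (?g (?n - 1))) < ?n" by simp
  ultimately show "\<omega> (last (vertex_list (verts H) (p i)), i) \<in> block H (next_index s i)"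
    using ar i unfolding arranged_def block_def by (metis (no_types, lifting) SigmaI singletonI)
qed

section \<open>Proper colorings as a local condition\<close>

lemma simple_graph_edge:
  assumes "simple_graph H" "e \<in> edges H"
  obtains u v where "e = {u, v}" "u \<noteq> v" "u \<in> verts H" "v \<in> verts H"
  using assms unfolding simple_graph_def by (metis card_2_iff insert_subset)

text \<open>Writing all edges of the product as rectangles makes both the color of an edge and its coordinates
  accessible without choosing names for its endpoints.\<close>

lemma edges_times_cycle:
  assumes "simple_graph H"
  shows "edges (times_cycle H s) =
    {e \<times> {i} | e i. e \<in> edges H \<and> i \<in> {1..s}} \<union>
    {{v} \<times> {i, next_index s i} | v i. v \<in> verts H \<and> i \<in> {1..s}}"
proof -
  have "{{(u, x), (v, x)} | u v x. {u, v} \<in> edges H \<and> x \<in> {1..s}} =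
      {e \<times> {i} | e i. e \<in> edges H \<and> i \<in> {1..s}}" (is "?A = ?B")
  proof
    have "\<exists>e i. {(u, x), (v, x)} = e \<times> {i} \<and> e \<in> edges H \<and> i \<in> {1..s}"
      if "{u, v} \<in> edges H" "x \<in> {1..s}" for u v x
      using that by (intro exI[of _ "{u, v}"] exI[of _ x]) auto
    then show "?A \<subseteq> ?B" by blast
    have "\<exists>u v x. e \<times> {i} = {(u, x), (v, x)} \<and> {u, v} \<in> edges H \<and> x \<in> {1..s}"
      if e: "e \<in> edges H" and i: "i \<in> {1..s}" for e i
    proof -
      obtain u v where "e = {u, v}" using simple_graph_edge[OF assms e] .
      with e i show ?thesis by (intro exI[of _ u] exI[of _ v] exI[of _ i]) auto
    qed
    then show "?B \<subseteq> ?A" by blast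
  qed
  moreover have "{{(u, x), (u, y)} | u x y. u \<in> verts H \<and>
        {x, y} \<in> {{i, next_index s i} | i. i \<in> {1..s}}} =
      {{v} \<times> {i, next_index s i} | v i. v \<in> verts H \<and> i \<in> {1..s}}" (is "?A = ?B")
  proof
    have "\<exists>v i. {(u, x), (u, y)} = {v} \<times> {i, next_index s i} \<and> v \<in> verts H \<and> i \<in> {1..s}"
      if "u \<in> verts H" "{x, y} = {i, next_index s i}" "i \<in> {1..s}" for u x y i
    proof -
      have "{(u, x), (u, y)} = {u} \<times> {x, y}" by auto
      with that show ?thesis by metis
    qed
    then show "?A \<subseteq> ?B" by blast
    have "\<exists>u x y. {v} \<times> {i, next_index s i} = {(u, x), (u, y)} \<and> u \<in> verts H \<and>
        {x, y} \<in> {{i, next_index s i} | i. i \<in> {1..s}}"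
      if "v \<in> verts H" "i \<in> {1..s}" for v i
      using that by (intro exI[of _ v] exI[of _ i] exI[of _ "next_index s i"]) auto
    then show "?B \<subseteq> ?A" by blast
  qed
  ultimately show ?thesis by (simp add: cartesian_product_def cycle_graph_def)
qed

text \<open>Here the endpoints count as spanned. For an edge \<open>e\<close> inside a block and an edge leaving the block
  at \<open>w\<close>, this captures both ways of clashing at once: adjacency if \<open>w\<close> is an endpoint of \<open>e\<close>, and
  conflict if \<open>w\<close> lies strictly under \<open>e\<close>.\<close>

definition spans :: "('a \<Rightarrow> nat) \<Rightarrow> 'a set \<Rightarrow> 'a \<Rightarrow> bool" where
  "spans f e w \<longleftrightarrow> (\<exists>u v. e = {u, v} \<and> f u \<le> f w \<and> f w \<le> f v)"

lemma spans_doubleton: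
  "spans f {u, v} w \<longleftrightarrow> f u \<le> f w \<and> f w \<le> f v \<or> f v \<le> f w \<and> f w \<le> f u"
  unfolding spans_def by (auto simp: doubleton_eq_iff)

lemma crossing_doubletons:
  "crossing f {a, b} {u, v} \<longleftrightarrow>
    f a < f u \<and> f u < f b \<and> (f v < f a \<or> f b < f v) \<or>
    f b < f u \<and> f u < f a \<and> (f v < f b \<or> f a < f v) \<or>
    f a < f v \<and> f v < f b \<and> (f u < f a \<or> f b < f u) \<or>
    f b < f v \<and> f v < f a \<and> (f u < f b \<or> f a < f u)"
  unfolding crossing_def doubleton_eq_iff by blast

definition clash :: "('v \<Rightarrow> 'v) \<Rightarrow> 'v set \<Rightarrow> 'v set \<Rightarrow> bool" where
  "clash \<omega> e e' \<longleftrightarrow> adjacent e e' \<or> conflict \<omega> e e'"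

text \<open>The following lemmas determine when two edges of the product clash. The
  numbering is started at block \<open>i\<close>, the first of the blocks that matter. The
  assumption of three blocks ensures that the next two blocks are different from \<open>i\<close>, so that no
  edge in question passes through the point where the circle is cut.\<close>

locale block_layout =
  fixes H :: "'a graph" and s :: nat and p :: "nat \<Rightarrow> 'a \<Rightarrow> nat" and \<omega>
  assumes simple: "simple_graph H" and s3: "3 \<le> s" and arranged: "arranged H s p \<omega>"
begin

lemmas position_less = arranged_position_less[OF arranged]
lemmas position_eq_iff = arranged_position_eq_iff[OF arranged]

lemma edge_in:
  assumes "e \<in> edges H" "i \<in> {1..s}"
  shows "e \<times> {i} \<subseteq> verts (times_cycle H s)"
  using assms simple unfolding simple_graph_def verts_times_cycle by blast

lemma join_in:
  assumes "v \<in> verts H" "i \<in> {1..s}"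
  shows "{v} \<times> {i, next_index s i} \<subseteq> verts (times_cycle H s)"
  using assms next_index_in[OF assms(2)] unfolding verts_times_cycle by blast

lemma conflict_iff:
  assumes "e \<subseteq> verts (times_cycle H s)" "e' \<subseteq> verts (times_cycle H s)" "z \<in> {1..s}"
  shows "conflict \<omega> e e' \<longleftrightarrow> crossing (rank_from H s p z) e e'"
  using assms by (intro conflict_iff_crossing[OF arranged_cyclic_ranking[OF arranged]])

lemma rank_less_iff:
  assumes "v \<in> verts H" "i \<in> {1..s}" "w \<in> verts H" "k \<in> {1..s}"
  shows "rank_from H s p z (v, i) < rank_from H s p z (w, k) \<longleftrightarrow>
    offset s z i < offset s z k \<or> offset s z i = offset s z k \<and> p i v < p k w"
  using assms by (intro rank_from_less_iff position_less)

lemma offset_next_self: "i \<in> {1..s} \<Longrightarrow> offset s i (next_index s i) = 1"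
  using s3 by (simp add: offset_next)

lemma offset_next_next_self: "i \<in> {1..s} \<Longrightarrow> offset s i (next_index s (next_index s i)) = 2"
  using s3 next_index_in by (simp add: offset_next offset_next_self)

lemma offset_other:
  assumes "i \<in> {1..s}" "k \<in> {1..s}" "k \<noteq> i"
  shows "0 < offset s i k"
  using assms offset_eq_iff[of k s i i] by simp

lemma offset_other2:
  assumes "i \<in> {1..s}" "k \<in> {1..s}" "k \<noteq> i" "k \<noteq> next_index s i"
  shows "1 < offset s i k"
  using offset_other[OF assms(1-3)] offset_eq_iff[OF assms(2) next_index_in[OF assms(1)] assms(1)]
    offset_next_self[OF assms(1)] assms(4) by linarith

lemma clash_sym:
  assumes "e \<subseteq> verts (times_cycle H s)" "e' \<subseteq> verts (times_cycle H s)"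
  shows "clash \<omega> e e' \<longleftrightarrow> clash \<omega> e' e"
  using conflict_iff[OF assms, of 1] conflict_iff[OF assms(2,1), of 1] s3
  by (auto simp: clash_def adjacent_def crossing_sym[of _ e])

lemma clash_same_block:
  assumes e: "e \<in> edges H" "e' \<in> edges H" and i: "i \<in> {1..s}"
  shows "clash \<omega> (e \<times> {i}) (e' \<times> {i}) \<longleftrightarrow> adjacent e e' \<or> crossing (p i) e e'"
proof -
  obtain a b where ab: "e = {a, b}" "a \<noteq> b" "a \<in> verts H" "b \<in> verts H"
    using simple_graph_edge[OF simple e(1)] .
  obtain u v where uv: "e' = {u, v}" "u \<noteq> v" "u \<in> verts H" "v \<in> verts H"
    using simple_graph_edge[OF simple e(2)] .
  have prod: "{a, b} \<times> {i} = {(a, i), (b, i)}" "{u, v} \<times> {i} = {(u, i), (v, i)}" by auto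
  have "conflict \<omega> (e \<times> {i}) (e' \<times> {i}) \<longleftrightarrow> crossing (p i) e e'"
    unfolding conflict_iff[OF edge_in[OF e(1) i] edge_in[OF e(2) i] i]
    unfolding ab(1) uv(1) prod crossing_doubletons using ab uv i by (simp add: rank_less_iff)
  moreover have "adjacent (e \<times> {i}) (e' \<times> {i}) \<longleftrightarrow> adjacent e e'"
    unfolding adjacent_def by (auto simp: times_eq_iff)
  ultimately show ?thesis unfolding clash_def by blast
qed

lemma no_clash_other_block:
  assumes e: "e \<in> edges H" "e' \<in> edges H" and i: "i \<in> {1..s}" "k \<in> {1..s}" "i \<noteq> k"
  shows "\<not> clash \<omega> (e \<times> {i}) (e' \<times> {k})"
proof -
  obtain a b where ab: "e = {a, b}" "a \<noteq> b" "a \<in> verts H" "b \<in> verts H"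
    using simple_graph_edge[OF simple e(1)] .
  obtain u v where uv: "e' = {u, v}" "u \<noteq> v" "u \<in> verts H" "v \<in> verts H"
    using simple_graph_edge[OF simple e(2)] .
  have prod: "{a, b} \<times> {i} = {(a, i), (b, i)}" "{u, v} \<times> {k} = {(u, k), (v, k)}" by auto
  have "\<not> conflict \<omega> (e \<times> {i}) (e' \<times> {k})"
    unfolding conflict_iff[OF edge_in[OF e(1) i(1)] edge_in[OF e(2) i(2)] i(1)]
    unfolding ab(1) uv(1) prod crossing_doubletons
    using ab uv i offset_other[of i k] by (simp add: rank_less_iff)
  moreover have "\<not> adjacent (e \<times> {i}) (e' \<times> {k})"
    using i unfolding adjacent_def by auto
  ultimately show ?thesis unfolding clash_def by blast
qed

text \<open>One endpoint of the joining edge lies outside block \<open>k\<close>, so only the position of the other one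
  matters.\<close>

lemma clash_join:
  assumes e: "e \<in> edges H" and w: "w \<in> verts H" and i: "i \<in> {1..s}" and k: "k = i \<or> k = next_index s i"
  shows "clash \<omega> (e \<times> {k}) ({w} \<times> {i, next_index s i}) \<longleftrightarrow> spans (p k) e w"
proof -
  let ?j = "next_index s i"
  obtain a b where ab: "e = {a, b}" "a \<noteq> b" "a \<in> verts H" "b \<in> verts H"
    using simple_graph_edge[OF simple e(1)] .
  have j: "?j \<in> {1..s}" "?j \<noteq> i" using next_index_in[OF i] next_index_neq[of s i] s3 i by auto
  have kin: "k \<in> {1..s}" using k i j by blast
  have prod: "{a, b} \<times> {k} = {(a, k), (b, k)}" "{w} \<times> {i, ?j} = {(w, i), (w, ?j)}" by auto
  have conf: "conflict \<omega> (e \<times> {k}) ({w} \<times> {i, ?j}) \<longleftrightarrow>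
      p k a < p k w \<and> p k w < p k b \<or> p k b < p k w \<and> p k w < p k a"
    unfolding conflict_iff[OF edge_in[OF e kin] join_in[OF w i] i]
    unfolding ab(1) prod crossing_doubletons
    using ab w i j offset_next_self[OF i]
    by (cases "k = i") (use k in \<open>simp_all add: rank_less_iff\<close>)
  have "snd ` (e \<times> {k}) \<noteq> snd ` ({w} \<times> {i, ?j})" using j(2) by (auto simp: doubleton_eq_iff)
  then have "e \<times> {k} \<noteq> {w} \<times> {i, ?j}" by metis
  then have adj: "adjacent (e \<times> {k}) ({w} \<times> {i, ?j}) \<longleftrightarrow> w = a \<or> w = b"
    unfolding adjacent_def using k ab(1) by auto
  show ?thesis
    unfolding clash_def conf adj unfolding ab(1) spans_doubleton
    using position_eq_iff[OF kin ab(3) w] position_eq_iff[OF kin ab(4) w] by auto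
qed

lemma no_clash_join:
  assumes e: "e \<in> edges H" and w: "w \<in> verts H" and i: "i \<in> {1..s}"
    and k: "k \<in> {1..s}" "k \<noteq> i" "k \<noteq> next_index s i"
  shows "\<not> clash \<omega> (e \<times> {k}) ({w} \<times> {i, next_index s i})"
proof -
  let ?j = "next_index s i"
  obtain a b where ab: "e = {a, b}" "a \<noteq> b" "a \<in> verts H" "b \<in> verts H"
    using simple_graph_edge[OF simple e(1)] .
  have j: "?j \<in> {1..s}" by (rule next_index_in[OF i])
  have prod: "{a, b} \<times> {k} = {(a, k), (b, k)}" "{w} \<times> {i, ?j} = {(w, i), (w, ?j)}" by auto
  have "\<not> conflict \<omega> (e \<times> {k}) ({w} \<times> {i, ?j})"
    unfolding conflict_iff[OF edge_in[OF e k(1)] join_in[OF w i] i]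
    unfolding ab(1) prod crossing_doubletons
    using k ab w i j offset_next_self[OF i] offset_other2[OF i k] by (simp add: rank_less_iff)
  moreover have "\<not> adjacent (e \<times> {k}) ({w} \<times> {i, ?j})" using k unfolding adjacent_def by auto
  ultimately show ?thesis unfolding clash_def by blast
qed

text \<open>Two chords joining the same two blocks are nested exactly if their endpoints occur in opposite
  orders in the two blocks.\<close>

lemma clash_parallel_joins:
  assumes v: "v \<in> verts H" and w: "w \<in> verts H" and i: "i \<in> {1..s}"
  shows "clash \<omega> ({v} \<times> {i, next_index s i}) ({w} \<times> {i, next_index s i}) \<longleftrightarrow>
    p i v < p i w \<and> p (next_index s i) v < p (next_index s i) w \<or>
    p i w < p i v \<and> p (next_index s i) w < p (next_index s i) v"
proof -
  let ?j = "next_index s i"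
  have j: "?j \<in> {1..s}" by (rule next_index_in[OF i])
  have prod: "{v} \<times> {i, ?j} = {(v, i), (v, ?j)}" "{w} \<times> {i, ?j} = {(w, i), (w, ?j)}" by auto
  have "conflict \<omega> ({v} \<times> {i, ?j}) ({w} \<times> {i, ?j}) \<longleftrightarrow>
      p i v < p i w \<and> p ?j v < p ?j w \<or> p i w < p i v \<and> p ?j w < p ?j v"
    unfolding conflict_iff[OF join_in[OF v i] join_in[OF w i] i]
    unfolding prod crossing_doubletons
    using v w i j offset_next_self[OF i] by (simp add: rank_less_iff conj_commute)
  moreover have "\<not> adjacent ({v} \<times> {i, ?j}) ({w} \<times> {i, ?j})" unfolding adjacent_def by auto
  ultimately show ?thesis unfolding clash_def by blast
qed

text \<open>The first edge comes from behind, the second goes ahead. They are disjoint chords if the first one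
  ends, in the common block \<open>j\<close>, before the second one starts.\<close>

lemma clash_consecutive_joins:
  assumes v: "v \<in> verts H" and w: "w \<in> verts H" and i: "i \<in> {1..s}" and j: "j = next_index s i"
  shows "clash \<omega> ({v} \<times> {i, j}) ({w} \<times> {j, next_index s j}) \<longleftrightarrow> p j w \<le> p j v"
proof -
  let ?k = "next_index s j"
  have jk: "j \<in> {1..s}" "?k \<in> {1..s}" "j \<noteq> i" "?k \<noteq> i" "?k \<noteq> j"
    using i j next_index_in next_index_neq next_next_index_neq[of s i] s3 by auto
  have prod: "{v} \<times> {i, j} = {(v, i), (v, j)}" "{w} \<times> {j, ?k} = {(w, j), (w, ?k)}" by auto
  have conf: "conflict \<omega> ({v} \<times> {i, j}) ({w} \<times> {j, ?k}) \<longleftrightarrow> p j w < p j v"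
    unfolding conflict_iff[OF join_in[OF v i, folded j] join_in[OF w jk(1)] i]
    unfolding prod crossing_doubletons
    using v w i jk offset_next_self[OF i] offset_next_next_self[OF i] j
    by (simp add: rank_less_iff)
  have "{v} \<times> {i, j} \<noteq> {w} \<times> {j, ?k}" using jk by (auto simp: times_eq_iff)
  then have adj: "adjacent ({v} \<times> {i, j}) ({w} \<times> {j, ?k}) \<longleftrightarrow> v = w"
    using jk unfolding adjacent_def by auto
  show ?thesis
    unfolding clash_def conf adj using position_eq_iff[OF jk(1) v w] by auto
qed

lemma no_clash_distant_joins:
  assumes v: "v \<in> verts H" and w: "w \<in> verts H" and i: "i \<in> {1..s}" and k: "k \<in> {1..s}" "k \<noteq> i"
    "k \<noteq> next_index s i" "next_index s k \<noteq> i"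
  shows "\<not> clash \<omega> ({v} \<times> {i, next_index s i}) ({w} \<times> {k, next_index s k})"
proof -
  let ?j = "next_index s i" and ?l = "next_index s k"
  have jl: "?j \<in> {1..s}" "?l \<in> {1..s}" using next_index_in i k by auto
  have l: "?l \<noteq> ?j" using next_index_inj[OF k(1) i] k by simp
  have prod: "{v} \<times> {i, ?j} = {(v, i), (v, ?j)}" "{w} \<times> {k, ?l} = {(w, k), (w, ?l)}" by auto
  have "\<not> conflict \<omega> ({v} \<times> {i, ?j}) ({w} \<times> {k, ?l})"
    unfolding conflict_iff[OF join_in[OF v i] join_in[OF w k(1)] i]
    unfolding prod crossing_doubletons
    using v w i k jl offset_next_self[OF i] offset_other2[OF i k(1-3)] offset_other2[OF i jl(2) k(4) l]
    by (simp add: rank_less_iff)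
  moreover have "\<not> adjacent ({v} \<times> {i, ?j}) ({w} \<times> {k, ?l})"
    using k l unfolding adjacent_def by auto
  ultimately show ?thesis unfolding clash_def by blast
qed

end

text \<open>The local form of the condition on the colors: \<open>f i\<close> colors the edges inside block \<open>i\<close>, and \<open>g i\<close>
  colors the edges from block \<open>i\<close> to the next block, each named by its first coordinate. The five
  clauses correspond to the five kinds of edge pairs that can clash: both inside the same block; one
  inside a block and one leaving or entering it; both joining the same two blocks; and one entering
  and one leaving the same block.\<close>

definition locally_proper ::
    "'a graph \<Rightarrow> nat \<Rightarrow> (nat \<Rightarrow> 'a \<Rightarrow> nat) \<Rightarrow> (nat \<Rightarrow> 'a set \<Rightarrow> nat) \<Rightarrow> (nat \<Rightarrow> 'a \<Rightarrow> nat) \<Rightarrow> bool" where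
  "locally_proper H s p f g \<longleftrightarrow> (\<forall>i\<in>{1..s}.
     (\<forall>e\<in>edges H. \<forall>e'\<in>edges H. adjacent e e' \<or> crossing (p i) e e' \<longrightarrow> f i e \<noteq> f i e') \<and>
     (\<forall>e\<in>edges H. \<forall>v\<in>verts H. spans (p i) e v \<longrightarrow> f i e \<noteq> g i v) \<and>
     (\<forall>e\<in>edges H. \<forall>v\<in>verts H. spans (p (next_index s i)) e v \<longrightarrow> f (next_index s i) e \<noteq> g i v) \<and>
     (\<forall>v\<in>verts H. \<forall>w\<in>verts H. p i v < p i w \<and> p (next_index s i) v < p (next_index s i) w \<longrightarrow>
        g i v \<noteq> g i w) \<and>
     (\<forall>v\<in>verts H. \<forall>w\<in>verts H. p (next_index s i) w \<le> p (next_index s i) v \<longrightarrow>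
        g i v \<noteq> g (next_index s i) w))"

lemma locally_properD:
  assumes "locally_proper H s p f g" "i \<in> {1..s}"
  shows "e \<in> edges H \<Longrightarrow> e' \<in> edges H \<Longrightarrow> adjacent e e' \<or> crossing (p i) e e' \<Longrightarrow> f i e \<noteq> f i e'"
    and "e \<in> edges H \<Longrightarrow> v \<in> verts H \<Longrightarrow> spans (p i) e v \<Longrightarrow> f i e \<noteq> g i v"
    and "e \<in> edges H \<Longrightarrow> v \<in> verts H \<Longrightarrow> spans (p (next_index s i)) e v \<Longrightarrow>
      f (next_index s i) e \<noteq> g i v"
    and "v \<in> verts H \<Longrightarrow> w \<in> verts H \<Longrightarrow>
      p i v < p i w \<and> p (next_index s i) v < p (next_index s i) w \<Longrightarrow> g i v \<noteq> g i w"
    and "v \<in> verts H \<Longrightarrow> w \<in> verts H \<Longrightarrow> p (next_index s i) w \<le> p (next_index s i) v \<Longrightarrow>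
      g i v \<noteq> g (next_index s i) w"
  using assms unfolding locally_proper_def by blast+

lemma locally_proper_cong:
  assumes "\<And>i e. i \<in> {1..s} \<Longrightarrow> e \<in> edges H \<Longrightarrow> f i e = f' i e"
    and "\<And>i v. i \<in> {1..s} \<Longrightarrow> v \<in> verts H \<Longrightarrow> g i v = g' i v"
  shows "locally_proper H s p f g \<longleftrightarrow> locally_proper H s p f' g'"
  unfolding locally_proper_def
  by (intro ball_cong refl conj_cong) (simp_all only: assms next_index_in)

text \<open>Up to exchanging the two edges, every pair falls under one of the lemmas on clashes above.\<close>

lemma (in block_layout) proper_iff_locally_proper:
  "(\<forall>e\<in>edges (times_cycle H s). \<forall>e'\<in>edges (times_cycle H s).
      adjacent e e' \<or> conflict \<omega> e e' \<longrightarrow> c e \<noteq> c e') \<longleftrightarrow>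
    locally_proper H s p (\<lambda>i e. c (e \<times> {i})) (\<lambda>i v. c ({v} \<times> {i, next_index s i}))"
    (is "?proper \<longleftrightarrow> ?local")
proof
  assume proper: ?proper
  have ins: "e \<times> {i} \<in> edges (times_cycle H s)" if "e \<in> edges H" "i \<in> {1..s}" for e i
    using that unfolding edges_times_cycle[OF simple] by blast
  have jn: "{v} \<times> {i, next_index s i} \<in> edges (times_cycle H s)" if "v \<in> verts H" "i \<in> {1..s}" for v i
    using that unfolding edges_times_cycle[OF simple] by blast
  note P = proper[folded clash_def, rule_format]
  show ?local unfolding locally_proper_def
  proof (intro ballI conjI impI)
    fix i assume i: "i \<in> {1..s}"
    have k: "next_index s i \<in> {1..s}" by (rule next_index_in[OF i])
    { fix e e' assume "e \<in> edges H" "e' \<in> edges H" "adjacent e e' \<or> crossing (p i) e e'"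
      then show "c (e \<times> {i}) \<noteq> c (e' \<times> {i})"
        using P[OF ins[OF _ i] ins[OF _ i]] clash_same_block[OF _ _ i] by blast }
    { fix e v assume "e \<in> edges H" "v \<in> verts H" "spans (p i) e v"
      then show "c (e \<times> {i}) \<noteq> c ({v} \<times> {i, next_index s i})"
        using P[OF ins[OF _ i] jn[OF _ i]] clash_join[OF _ _ i, of _ _ i] by blast }
    { fix e v assume "e \<in> edges H" "v \<in> verts H" "spans (p (next_index s i)) e v"
      then show "c (e \<times> {next_index s i}) \<noteq> c ({v} \<times> {i, next_index s i})"
        using P[OF ins[OF _ k] jn[OF _ i]] clash_join[OF _ _ i, of _ _ "next_index s i"] by blast }
    { fix v w assume "v \<in> verts H" "w \<in> verts H"
        "p i v < p i w \<and> p (next_index s i) v < p (next_index s i) w"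
      then show "c ({v} \<times> {i, next_index s i}) \<noteq> c ({w} \<times> {i, next_index s i})"
        using P[OF jn[OF _ i] jn[OF _ i]] clash_parallel_joins[OF _ _ i] by blast }
    { fix v w assume "v \<in> verts H" "w \<in> verts H" "p (next_index s i) w \<le> p (next_index s i) v"
      then show "c ({v} \<times> {i, next_index s i}) \<noteq>
          c ({w} \<times> {next_index s i, next_index s (next_index s i)})"
        using P[OF jn[OF _ i] jn[OF _ k]] clash_consecutive_joins[OF _ _ i refl] by blast }
  qed
next
  assume loc: ?local
  note L = loc[unfolded locally_proper_def, rule_format]
  have ii: "c (e \<times> {i}) \<noteq> c (e' \<times> {k})"
    if "e \<in> edges H" "e' \<in> edges H" "i \<in> {1..s}" "k \<in> {1..s}" "clash \<omega> (e \<times> {i}) (e' \<times> {k})" for e e' i k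
  proof (cases "i = k")
    case True
    then have "adjacent e e' \<or> crossing (p k) e e'" using clash_same_block that by blast
    then show ?thesis using L[OF \<open>k \<in> _\<close>] that True by blast
  qed (use no_clash_other_block that in blast)
  have ij: "c (e \<times> {k}) \<noteq> c ({v} \<times> {i, next_index s i})"
    if "e \<in> edges H" "v \<in> verts H" "i \<in> {1..s}" "k \<in> {1..s}"
      "clash \<omega> (e \<times> {k}) ({v} \<times> {i, next_index s i})" for e v i k
  proof -
    have k: "k = i \<or> k = next_index s i" using no_clash_join that by blast
    then have "spans (p k) e v" using clash_join that by blast
    then show ?thesis using L[OF \<open>i \<in> _\<close>] that k by blast
  qed
  have jj: "c ({v} \<times> {i, next_index s i}) \<noteq> c ({w} \<times> {k, next_index s k})"
    if "v \<in> verts H" "w \<in> verts H" "i \<in> {1..s}" "k \<in> {1..s}"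
      "clash \<omega> ({v} \<times> {i, next_index s i}) ({w} \<times> {k, next_index s k})" for v w i k
  proof -
    note cl = that(5)
    have sym: "clash \<omega> ({w} \<times> {k, next_index s k}) ({v} \<times> {i, next_index s i})"
      using clash_sym join_in that by blast
    consider "k = i" | "k = next_index s i" | "i = next_index s k"
      using no_clash_distant_joins[OF \<open>v \<in> _\<close> \<open>w \<in> _\<close> \<open>i \<in> _\<close> \<open>k \<in> _\<close>]
        cl by blast
    then show ?thesis
    proof cases
      case 1
      then show ?thesis using clash_parallel_joins L[OF \<open>i \<in> _\<close>] that by metis
    next
      case 2
      then show ?thesis using clash_consecutive_joins L[OF \<open>i \<in> _\<close>] that by metis
    next
      case 3
      then show ?thesis using clash_consecutive_joins L[OF \<open>k \<in> _\<close>] that sym by metis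
    qed
  qed
  show ?proper
  proof (intro ballI impI, fold clash_def)
    fix X Y assume X: "X \<in> edges (times_cycle H s)" and Y: "Y \<in> edges (times_cycle H s)"
      and cl: "clash \<omega> X Y"
    have edge_cases: "(\<exists>e i. Z = e \<times> {i} \<and> e \<in> edges H \<and> i \<in> {1..s}) \<or>
        (\<exists>v i. Z = {v} \<times> {i, next_index s i} \<and> v \<in> verts H \<and> i \<in> {1..s})"
      if "Z \<in> edges (times_cycle H s)" for Z
      using that unfolding edges_times_cycle[OF simple] by blast
    from edge_cases[OF X] show "c X \<noteq> c Y"
    proof (elim disjE exE conjE)
      fix e i assume Xe: "X = e \<times> {i}" "e \<in> edges H" "i \<in> {1..s}"
      from edge_cases[OF Y] show ?thesis using ii ij Xe cl by metis
    next
      fix v i assume Xv: "X = {v} \<times> {i, next_index s i}" "v \<in> verts H" "i \<in> {1..s}"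
      from edge_cases[OF Y] show ?thesis
      proof (elim disjE exE conjE)
        fix e k assume Ye: "Y = e \<times> {k}" "e \<in> edges H" "k \<in> {1..s}"
        have "clash \<omega> Y X" using cl clash_sym edge_in join_in Xv Ye by metis
        then show ?thesis using ij Xv Ye by metis
      next
        fix w k assume "Y = {w} \<times> {k, next_index s k}" "w \<in> verts H" "k \<in> {1..s}"
        then show ?thesis using jj Xv cl by metis
      qed
    qed
  qed
qed

text \<open>The colors inside the blocks and between them can be prescribed independently, as a rectangle
  determines its block or its pair of consecutive blocks. The latter needs three blocks: for \<open>s = 2\<close>
  the pairs \<open>{1, 2}\<close> and \<open>{2, 1}\<close> would coincide.\<close>

lemma glued_coloring:
  assumes s: "3 \<le> s"
  obtains c :: "('a \<times> nat) set \<Rightarrow> nat" where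
    "\<And>e i. e \<noteq> {} \<Longrightarrow> c (e \<times> {i}) = f i e"
    "\<And>v i. i \<in> {1..s} \<Longrightarrow> c ({v} \<times> {i, next_index s i}) = g i v"
proof -
  define c :: "('a \<times> nat) set \<Rightarrow> nat" where
    "c X = (if is_singleton (snd ` X) then f (the_elem (snd ` X)) (fst ` X)
      else g (THE i. i \<in> {1..s} \<and> snd ` X = {i, next_index s i}) (the_elem (fst ` X)))" for X
  show thesis
  proof
    show "c (e \<times> {i}) = f i e" if "e \<noteq> {}" for e i
      using that by (simp add: c_def)
    fix v i assume i: "i \<in> {1..s}"
    have "next_index s i \<noteq> i" using s i next_index_neq[of s i] by simp
    moreover have "(THE k. k \<in> {1..s} \<and> {i, next_index s i} = {k, next_index s k}) = i"
    proof (rule the_equality)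
      fix k assume k: "k \<in> {1..s} \<and> {i, next_index s i} = {k, next_index s k}"
      then show "k = i" using next_next_index_neq[OF s i] by (auto simp: doubleton_eq_iff)
    qed (use i in auto)
    ultimately show "c ({v} \<times> {i, next_index s i}) = g i v"
      by (simp add: c_def is_singleton_def)
  qed
qed

section \<open>The two colors missing from a seed\<close>

lemma image_block_edges:
  assumes simple: "simple_graph H" and s: "2 \<le> s" and j: "j \<in> {1..s}"
  shows "c ` block_edges H s j = (\<lambda>e. c (e \<times> {j})) ` edges H"
proof -
  have "block_edges H s j = (\<lambda>e. e \<times> {j}) ` edges H"
  proof
    show "block_edges H s j \<subseteq> (\<lambda>e. e \<times> {j}) ` edges H"
    proof
      fix X assume "X \<in> block_edges H s j"
      then have X: "X \<in> edges (times_cycle H s)" "X \<subseteq> verts H \<times> {j}"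
        by (auto simp: block_edges_def block_def)
      from X(1) consider e i where "X = e \<times> {i}" "e \<in> edges H"
        | v i where "X = {v} \<times> {i, next_index s i}" "i \<in> {1..s}"
        unfolding edges_times_cycle[OF simple] by blast
      then show "X \<in> (\<lambda>e. e \<times> {j}) ` edges H"
      proof cases
        case 1
        then have "i = j" using simple_graph_edge[OF simple 1(2)] X(2) by blast
        with 1 show ?thesis by blast
      next
        case 2
        then have "i = j" "next_index s i = j" using X(2) by auto
        then show ?thesis using next_index_neq[OF s 2(2)] by simp
      qed
    qed
    show "(\<lambda>e. e \<times> {j}) ` edges H \<subseteq> block_edges H s j"
      using simple j unfolding simple_graph_def block_edges_def edges_times_cycle[OF simple] block_def
      by blast
  qed
  then show ?thesis by (simp add: image_image)
qed

lemma image_after_matching: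
  assumes simple: "simple_graph H" and s: "3 \<le> s" and j: "j \<in> {1..s}"
  shows "c ` after_matching H s j = (\<lambda>v. c ({v} \<times> {j, next_index s j})) ` verts H"
proof -
  let ?k = "next_index s j"
  have k: "?k \<noteq> j" using s j next_index_neq[of s j] by simp
  have "after_matching H s j = (\<lambda>v. {v} \<times> {j, ?k}) ` verts H"
  proof
    show "after_matching H s j \<subseteq> (\<lambda>v. {v} \<times> {j, ?k}) ` verts H"
    proof
      fix X assume "X \<in> after_matching H s j"
      then obtain x y where X: "X \<in> edges (times_cycle H s)" "X = {(x, j), (y, ?k)}"
          "x \<in> verts H"
        by (auto simp: after_matching_def joining_edges_def block_def)
      have snd: "snd ` X = {j, ?k}" using X(2) by simp
      from X(1) consider e i where "X = e \<times> {i}" "e \<in> edges H"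
        | v i where "X = {v} \<times> {i, next_index s i}" "i \<in> {1..s}"
        unfolding edges_times_cycle[OF simple] by blast
      then show "X \<in> (\<lambda>v. {v} \<times> {j, ?k}) ` verts H"
      proof cases
        case 1
        then have "snd ` X \<subseteq> {i}" by auto
        then show ?thesis using snd k by auto
      next
        case 2
        then have "x = v" "y = v" using X(2) by auto
        then have "X = {v} \<times> {j, ?k}" using X(2) by auto
        with X(3) \<open>x = v\<close> show ?thesis by blast
      qed
    qed
    have "{v} \<times> {j, ?k} \<in> after_matching H s j" if "v \<in> verts H" for v
    proof -
      have "{v} \<times> {j, ?k} \<in> edges (times_cycle H s)"
        using that j unfolding edges_times_cycle[OF simple] by blast
      moreover have "{v} \<times> {j, ?k} = {(v, j), (v, ?k)}" by auto
      ultimately show ?thesis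
        using that unfolding after_matching_def joining_edges_def block_def by blast
    qed
    then show "(\<lambda>v. {v} \<times> {j, ?k}) ` verts H \<subseteq> after_matching H s j" by blast
  qed
  then show ?thesis by (simp add: image_image)
qed

lemma prev_index_in: "j \<in> {1..s} \<Longrightarrow> prev_index s j \<in> {1..s}"
  by (auto simp: prev_index_def)

lemma next_prev_index: "j \<in> {1..s} \<Longrightarrow> next_index s (prev_index s j) = j"
  by (auto simp: prev_index_def next_index_def)

lemma before_matching_eq_after_matching:
  "j \<in> {1..s} \<Longrightarrow> before_matching H s j = after_matching H s (prev_index s j)"
  by (simp add: before_matching_def after_matching_def next_prev_index)

text \<open>The edges of the color of \<open>{u, v}\<close> lying under \<open>{u, v}\<close> form a perfect matching of the vertices
  strictly between \<open>u\<close> and \<open>v\<close>: by assumption each such vertex is on an edge of this color, and the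
  other end of that edge can neither be \<open>u\<close> or \<open>v\<close> nor lie outside.\<close>

lemma nested_edges_odd_span:
  assumes simple: "simple_graph H" and bij: "bij_betw p (verts H) {..<card (verts H)}"
    and proper: "\<And>d d'. d \<in> edges H \<Longrightarrow> d' \<in> edges H \<Longrightarrow>
      adjacent d d' \<or> crossing p d d' \<Longrightarrow> f d \<noteq> f d'"
    and e: "{u, v} \<in> edges H" and uv: "p u < p v"
    and covered: "\<And>z. z \<in> verts H \<Longrightarrow> spans p {u, v} z \<Longrightarrow> \<exists>d\<in>edges H. z \<in> d \<and> f d = f {u, v}"
  shows "odd (p v - p u)"
proof -
  define S where "S = {z \<in> verts H. p u < p z \<and> p z < p v}"
  define P where "P = {d \<in> edges H. f d = f {u, v} \<and> d \<subseteq> S}"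
  have V: "u \<in> verts H" "v \<in> verts H" using simple e unfolding simple_graph_def by auto
  have fin: "finite S" using simple unfolding S_def simple_graph_def by simp
  have "\<exists>d\<in>P. z \<in> d" if z: "z \<in> S" for z
  proof -
    have "spans p {u, v} z" "z \<in> verts H" using z unfolding S_def spans_doubleton by auto
    then obtain d where d: "d \<in> edges H" "z \<in> d" "f d = f {u, v}" using covered by blast
    then obtain w where w: "d = {z, w}" "w \<in> verts H"
      using simple_graph_edge[OF simple d(1)] by (metis doubleton_eq_iff insertE singletonD)
    have "\<not> (adjacent {u, v} d \<or> crossing p {u, v} d)" using proper[OF e d(1)] d(3) by metis
    moreover have "d \<noteq> {u, v}" using d(2) z unfolding S_def by auto
    ultimately have "w \<noteq> u" "w \<noteq> v" "\<not> crossing p {u, v} {z, w}"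
      using w unfolding adjacent_def by auto
    moreover have "p w \<noteq> p u" "p w \<noteq> p v"
      using bij V w(2) \<open>w \<noteq> u\<close> \<open>w \<noteq> v\<close> unfolding bij_betw_def inj_on_def by metis+
    ultimately have "w \<in> S"
      using z w(2) unfolding S_def crossing_doubletons by auto
    then show ?thesis using d z w unfolding P_def by auto
  qed
  then have S: "\<Union>P = S" unfolding P_def by blast
  have "2 dvd card (\<Union>P)"
  proof (rule dvd_partition)
    show "finite (\<Union>P)" using S fin by simp
    show "\<forall>d\<in>P. 2 dvd card d" using simple unfolding P_def simple_graph_def by simp
    show "\<forall>d\<in>P. \<forall>d'\<in>P. d \<noteq> d' \<longrightarrow> d \<inter> d' = {}"
      using proper unfolding P_def adjacent_def by (metis (mono_tags, lifting) mem_Collect_eq)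
  qed
  moreover have "card S = p v - p u - 1"
  proof -
    have "p ` S = {p u<..<p v}"
    proof
      have "\<exists>z\<in>verts H. p z = m" if "m < p v" for m
      proof -
        have "m < card (verts H)" using that bij_betwE[OF bij] V(2) by fastforce
        then have "m \<in> p ` verts H" using bij unfolding bij_betw_def by auto
        then show ?thesis by auto
      qed
      then show "{p u<..<p v} \<subseteq> p ` S" unfolding S_def by fastforce
    qed (auto simp: S_def)
    moreover have "inj_on p S" using bij unfolding bij_betw_def S_def inj_on_def by auto
    ultimately show ?thesis using card_image by fastforce
  qed
  ultimately have "even (p v - p u - 1)" using S by simp
  then show ?thesis using uv by simp
qed

text \<open>To be applied to a seed, with \<open>g1\<close> and \<open>g2\<close> the colors of its two matchings and \<open>D\<close> the set of all
  colors but one. Each vertex is on \<open>t + 2\<close> edges of distinct colors from \<open>D\<close>, so it sees every color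
  in \<open>D\<close>. For a vertex under an edge \<open>e\<close>, the color of \<open>e\<close> must come from inside the block, since an
  edge leaving the block there would cross \<open>e\<close>. Therefore the positions of the ends of every edge
  have opposite parity.\<close>

lemma bipartite_if_matchings_share_missing_color:
  assumes simple: "simple_graph H" and reg: "regular t H"
    and bij: "bij_betw p (verts H) {..<card (verts H)}"
    and proper: "\<And>d d'. d \<in> edges H \<Longrightarrow> d' \<in> edges H \<Longrightarrow>
      adjacent d d' \<or> crossing p d d' \<Longrightarrow> f d \<noteq> f d'"
    and span1: "\<And>d z. d \<in> edges H \<Longrightarrow> z \<in> verts H \<Longrightarrow> spans p d z \<Longrightarrow> f d \<noteq> g1 z"
    and span2: "\<And>d z. d \<in> edges H \<Longrightarrow> z \<in> verts H \<Longrightarrow> spans p d z \<Longrightarrow> f d \<noteq> g2 z"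
    and ne: "\<And>z. z \<in> verts H \<Longrightarrow> g1 z \<noteq> g2 z"
    and colors: "f ` edges H \<subseteq> D" "g1 ` verts H \<subseteq> D" "g2 ` verts H \<subseteq> D"
    and D: "finite D" "card D = t + 2"
  shows "bipartite H"
proof -
  have all: "f ` {d \<in> edges H. z \<in> d} \<union> {g1 z, g2 z} = D" if z: "z \<in> verts H" for z
  proof (rule card_subset_eq[OF D(1)])
    let ?F = "f ` {d \<in> edges H. z \<in> d}"
    show "?F \<union> {g1 z, g2 z} \<subseteq> D" using colors z by blast
    then have fin: "finite ?F" using D(1) finite_subset by blast
    have "inj_on f {d \<in> edges H. z \<in> d}"
      using proper unfolding adjacent_def by (intro inj_onI) blast
    then have "card ?F = t" using reg z card_image unfolding regular_def by metis
    moreover have "spans p d z" if "d \<in> edges H" "z \<in> d" for d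
      using simple_graph_edge[OF simple that(1)] that(2) unfolding spans_def
      by (metis doubleton_eq_iff insertE le_cases order_refl singletonD)
    then have "g1 z \<notin> ?F" "g2 z \<notin> ?F" using span1 span2 z by (fastforce)+
    ultimately show "card (?F \<union> {g1 z, g2 z}) = card D" using fin ne[OF z] D by simp
  qed
  \<comment> \<open>A joining edge at \<open>z\<close> with the color of \<open>e\<close> would clash with \<open>e\<close>.\<close>
  have covered: "\<exists>d\<in>edges H. z \<in> d \<and> f d = f e" if "e \<in> edges H" "z \<in> verts H" "spans p e z" for e z
  proof -
    have "f e \<in> f ` {d \<in> edges H. z \<in> d} \<union> {g1 z, g2 z}" using all that colors by blast
    then have "f e \<in> f ` {d \<in> edges H. z \<in> d}" using span1[OF that] span2[OF that] by simp
    then show ?thesis by auto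
  qed
  let ?X = "{v \<in> verts H. even (p v)}" and ?Y = "{v \<in> verts H. odd (p v)}"
  have "\<exists>x\<in>?X. \<exists>y\<in>?Y. e = {x, y}" if e: "e \<in> edges H" for e
  proof -
    obtain u v where uv: "e = {u, v}" "p u < p v" "u \<in> verts H" "v \<in> verts H"
    proof -
      obtain a b where ab: "e = {a, b}" "a \<noteq> b" "a \<in> verts H" "b \<in> verts H"
        using simple_graph_edge[OF simple e] .
      then have "p a \<noteq> p b" using bij unfolding bij_betw_def inj_on_def by blast
      then show ?thesis using that[of a b] that[of b a] ab by (metis insert_commute nat_neq_iff)
    qed
    have "odd (p v - p u)"
      using covered[OF e] unfolding uv(1)
      by (intro nested_edges_odd_span[where f = f, OF simple bij proper e[unfolded uv(1)] uv(2)])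
    then have "even (p u) \<noteq> even (p v)" using uv(2) by auto
    then show ?thesis using uv by (cases "even (p u)") auto
  qed
  then show ?thesis unfolding bipartite_def
    by (intro exI[of _ ?X] exI[of _ ?Y]) auto
qed

section \<open>Replacing a seed by alternately reversed copies\<close>

definition order_reversed :: "'a set \<Rightarrow> ('a \<Rightarrow> nat) \<Rightarrow> ('a \<Rightarrow> nat) \<Rightarrow> bool" where
  "order_reversed V f g \<longleftrightarrow> (\<forall>x\<in>V. \<forall>y\<in>V. g x < g y \<longleftrightarrow> f y < f x)"

lemma order_reversed_sym: "order_reversed V f g \<Longrightarrow> order_reversed V g f"
  unfolding order_reversed_def by blast

lemma order_reversed_mirror:
  assumes "\<And>v. v \<in> V \<Longrightarrow> f v < n"
  shows "order_reversed V f (\<lambda>v. n - Suc (f v))"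
  unfolding order_reversed_def
proof (intro ballI)
  fix x y assume "x \<in> V" "y \<in> V"
  then show "n - Suc (f x) < n - Suc (f y) \<longleftrightarrow> f y < f x"
    using assms[of x] assms[of y] by auto
qed

lemma crossing_order_reversed:
  assumes "simple_graph H" "order_reversed (verts H) f g" "e \<in> edges H" "e' \<in> edges H"
  shows "crossing g e e' \<longleftrightarrow> crossing f e e'"
proof -
  obtain a b where ab: "e = {a, b}" "a \<in> verts H" "b \<in> verts H"
    using simple_graph_edge[OF assms(1,3)] .
  obtain u v where uv: "e' = {u, v}" "u \<in> verts H" "v \<in> verts H"
    using simple_graph_edge[OF assms(1,4)] .
  have g: "g x < g y \<longleftrightarrow> f y < f x" if "x \<in> verts H" "y \<in> verts H" for x y
    using assms(2) that unfolding order_reversed_def by blast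
  show ?thesis unfolding ab(1) uv(1) crossing_doubletons using ab uv by (simp add: g) blast
qed

lemma spans_order_reversed:
  assumes "simple_graph H" "order_reversed (verts H) f g" "e \<in> edges H" "v \<in> verts H"
  shows "spans g e v \<longleftrightarrow> spans f e v"
proof -
  obtain a b where ab: "e = {a, b}" "a \<in> verts H" "b \<in> verts H"
    using simple_graph_edge[OF assms(1,3)] .
  have g: "g x \<le> g y \<longleftrightarrow> f y \<le> f x" if "x \<in> verts H" "y \<in> verts H" for x y
    using assms(2) that unfolding order_reversed_def by (metis linorder_not_less)
  show ?thesis unfolding ab(1) spans_doubleton using ab assms(4) by (simp add: g) blast
qed

text \<open>The block of the old product that a block of the new product is a copy of; the blocks
  \<open>j\<close> to \<open>j + r\<close> are the copies of the seed \<open>j\<close>.\<close>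

definition collapse :: "nat \<Rightarrow> nat \<Rightarrow> nat \<Rightarrow> nat" where
  "collapse j r i = (if i \<le> j then i else if i \<le> j + r then j else i - r)"

text \<open>Every second copy of the seed is reversed. With \<open>r\<close> even, the copies \<open>j\<close> and \<open>j + r\<close>, which
  have old neighbors, keep the original order.\<close>

definition stretch_positions ::
    "nat \<Rightarrow> nat \<Rightarrow> nat \<Rightarrow> (nat \<Rightarrow> 'a \<Rightarrow> nat) \<Rightarrow> nat \<Rightarrow> 'a \<Rightarrow> nat" where
  "stretch_positions n j r p i = (if i \<in> {j..j + r} \<and> odd (i - j)
     then (\<lambda>v. n - Suc (p j v)) else p (collapse j r i))"

text \<open>The matchings between copies of the seed get the colors \<open>b\<close>, \<open>a\<close>, \<open>b\<close>, \<open>a\<close>, \<dots> in this order.\<close>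

definition stretch_joins ::
    "nat \<Rightarrow> nat \<Rightarrow> nat \<Rightarrow> nat \<Rightarrow> (nat \<Rightarrow> 'a \<Rightarrow> nat) \<Rightarrow> nat \<Rightarrow> 'a \<Rightarrow> nat" where
  "stretch_joins a b j r g i = (if i \<in> {j..<j + r}
     then (\<lambda>v. if even (i - j) then b else a) else g (collapse j r i))"

lemma collapse_in: "j \<in> {1..s} \<Longrightarrow> i \<in> {1..s + r} \<Longrightarrow> collapse j r i \<in> {1..s}"
  by (auto simp: collapse_def)

text \<open>Outside the new matchings, consecutive blocks are copies of consecutive blocks, also at the end
  of the cycle. Here \<open>i\<close> may be the last copy \<open>j + r\<close> but not the first one.\<close>

lemma collapse_next_index:
  assumes "j \<in> {1..s}" "i \<in> {1..s + r}" "i \<notin> {j..<j + r}"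
  shows "collapse j r (next_index (s + r) i) = next_index s (collapse j r i)"
  using assms by (auto simp: collapse_def next_index_def)

lemma next_index_inner: "j \<in> {1..s} \<Longrightarrow> i \<in> {j..<j + r} \<Longrightarrow> next_index (s + r) i = Suc i"
  by (auto simp: next_index_def)

lemma stretch_positions_outer:
  assumes "even r" "j \<in> {1..s}" "i \<in> {1..s + r}" "i \<notin> {j..<j + r}"
  shows "stretch_positions n j r p i = p (collapse j r i)"
    "stretch_positions n j r p (next_index (s + r) i) = p (collapse j r (next_index (s + r) i))"
proof -
  show "stretch_positions n j r p i = p (collapse j r i)"
    using assms by (cases "i = j + r") (auto simp: stretch_positions_def)
  have "next_index (s + r) i \<in> {j..j + r} \<Longrightarrow> next_index (s + r) i = j"
    using assms by (auto simp: next_index_def split: if_splits)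
  then show "stretch_positions n j r p (next_index (s + r) i) =
      p (collapse j r (next_index (s + r) i))"
    unfolding stretch_positions_def by (metis even_zero diff_self_eq_0)
qed

lemma stretch_positions_cases:
  assumes less: "\<And>v. v \<in> V \<Longrightarrow> p j v < n"
  shows "stretch_positions n j r p i = p (collapse j r i) \<or>
    order_reversed V (p (collapse j r i)) (stretch_positions n j r p i)"
proof (cases "i \<in> {j..j + r} \<and> odd (i - j)")
  case True
  then have "collapse j r i = j" by (auto simp: collapse_def)
  moreover have "stretch_positions n j r p i = (\<lambda>v. n - Suc (p j v))"
    using True by (simp add: stretch_positions_def)
  moreover have "order_reversed V (p j) (\<lambda>v. n - Suc (p j v))"
    using less by (rule order_reversed_mirror)
  ultimately show ?thesis by simp
next
  case False
  then have "stretch_positions n j r p i = p (collapse j r i)"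
    unfolding stretch_positions_def by (rule if_not_P)
  then show ?thesis ..
qed

lemma stretch_positions_inner:
  assumes less: "\<And>v. v \<in> V \<Longrightarrow> p j v < n" and i: "i \<in> {j..<j + r}"
  shows "order_reversed V (stretch_positions n j r p i) (stretch_positions n j r p (Suc i))"
proof -
  have c: "collapse j r i = j" "collapse j r (Suc i) = j" using i by (auto simp: collapse_def)
  have *: "order_reversed V (p j) (\<lambda>v. n - Suc (p j v))"
    using less by (rule order_reversed_mirror)
  show ?thesis
    using i * order_reversed_sym[OF *] c
    by (cases "even (i - j)") (simp_all add: stretch_positions_def Suc_diff_le)
qed

lemma stretch_positions_bij:
  assumes bij: "\<And>i. i \<in> {1..s} \<Longrightarrow> bij_betw (p i) V {..<n}" and j: "j \<in> {1..s}" and i: "i \<in> {1..s + r}"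
  shows "bij_betw (stretch_positions n j r p i) V {..<n}"
proof (cases "i \<in> {j..j + r} \<and> odd (i - j)")
  case True
  have "bij_betw (\<lambda>m. n - Suc m) {..<n} {..<n}"
    by (rule bij_betwI[where g = "\<lambda>m. n - Suc m"]) auto
  from bij_betw_trans[OF bij[OF j] this] show ?thesis
    using True by (simp add: stretch_positions_def comp_def)
next
  case False
  then have "stretch_positions n j r p i = p (collapse j r i)"
    unfolding stretch_positions_def by (rule if_not_P)
  then show ?thesis using bij[OF collapse_in[OF j i]] by simp
qed

text \<open>Clauses about a single block carry over because reversing an order changes neither crossing nor
  \<open>spans\<close>, and because \<open>a\<close> and \<open>b\<close> do not occur inside the seed. A new matching has just one color,
  which is admissible as its chords are nested. What remains are consecutive matchings: two new ones
  differ in color, and the hypotheses on \<open>before\<close> and \<open>after\<close> settle the transitions at both ends.\<close>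

lemma locally_proper_stretch:
  assumes simple: "simple_graph H" and loc: "locally_proper H s p f g"
    and bij: "\<And>i. i \<in> {1..s} \<Longrightarrow> bij_betw (p i) (verts H) {..<n}"
    and j: "j \<in> {1..s}" and r: "even r" and ab: "a \<noteq> b"
    and f: "a \<notin> f j ` edges H" "b \<notin> f j ` edges H"
    and before: "b \<notin> g (prev_index s j) ` verts H" and after: "a \<notin> g j ` verts H"
  shows "locally_proper H (s + r) (stretch_positions n j r p) (\<lambda>i. f (collapse j r i))
    (stretch_joins a b j r g)"
    (is "locally_proper H ?s ?p ?f ?g")
proof -
  note L = locally_properD[OF loc]
  have less: "p j v < n" if "v \<in> verts H" for v
    using bij[OF j] that bij_betwE by fastforce
  note posc = stretch_positions_cases[where V = "verts H" and p = p and j = j and n = n, OF less]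
  have cross: "crossing (?p i) e e' \<longleftrightarrow> crossing (p (collapse j r i)) e e'"
    if "e \<in> edges H" "e' \<in> edges H" for i e e'
    using posc[of r i] crossing_order_reversed[OF simple _ that] by metis
  have span: "spans (?p i) e v \<longleftrightarrow> spans (p (collapse j r i)) e v"
    if "e \<in> edges H" "v \<in> verts H" for i e v
    using posc[of r i] spans_order_reversed[OF simple _ that] by metis
  have inner: "?g i v \<in> {a, b}" "collapse j r i = j" "collapse j r (Suc i) = j"
    if "i \<in> {j..<j + r}" for i v
    using that by (auto simp: stretch_joins_def collapse_def)
  have outer: "?g i = g (collapse j r i)" if "i \<notin> {j..<j + r}" for i
    using that unfolding stretch_joins_def by (rule if_not_P)
  have before': "b \<noteq> g i v" if "i \<in> {1..s}" "next_index s i = j" "v \<in> verts H" for i v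
    using before that next_index_inj[OF that(1) prev_index_in[OF j]] next_prev_index[OF j] by auto
  show ?thesis unfolding locally_proper_def
  proof (intro ballI conjI impI)
    fix i assume i: "i \<in> {1..?s}"
    let ?k = "next_index ?s i" and ?c = "collapse j r i"
    have k: "?k \<in> {1..?s}" by (rule next_index_in[OF i])
    have c: "?c \<in> {1..s}" by (rule collapse_in[OF j i])
    { fix e e' assume "e \<in> edges H" "e' \<in> edges H" "adjacent e e' \<or> crossing (?p i) e e'"
      then show "?f i e \<noteq> ?f i e'" using L(1)[OF c] cross by blast }
    { fix e v assume ev: "e \<in> edges H" "v \<in> verts H" "spans (?p i) e v"
      show "?f i e \<noteq> ?g i v"
      proof (cases "i \<in> {j..<j + r}")
        case True
        then show ?thesis using inner(1)[OF True, of v] inner(2,3)[OF True] f ev(1) by auto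
      next
        case False
        then show ?thesis using outer[OF False] L(2)[OF c] ev span by metis
      qed }
    { fix e v assume ev: "e \<in> edges H" "v \<in> verts H" "spans (?p ?k) e v"
      show "?f ?k e \<noteq> ?g i v"
      proof (cases "i \<in> {j..<j + r}")
        case True
        then show ?thesis
          using inner(1)[OF True, of v] inner(2,3)[OF True] next_index_inner[OF j True] f ev(1)
          by auto
      next
        case False
        then show ?thesis
          using outer[OF False] L(3)[OF c] ev span collapse_next_index[OF j i False] by metis
      qed }
    { fix v w assume vw: "v \<in> verts H" "w \<in> verts H" "?p i v < ?p i w \<and> ?p ?k v < ?p ?k w"
      show "?g i v \<noteq> ?g i w"
      proof (cases "i \<in> {j..<j + r}")
        case True
        have "order_reversed (verts H) (?p i) (?p (Suc i))"
          using less True by (rule stretch_positions_inner)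
        then have False
          using vw next_index_inner[OF j True] unfolding order_reversed_def by (metis less_asym)
        then show ?thesis ..
      next
        case False
        then show ?thesis
          using outer[OF False] L(4)[OF c vw(1,2)] vw(3) collapse_next_index[OF j i False]
            stretch_positions_outer[OF r j i False] by metis
      qed }
    { fix v w assume vw: "v \<in> verts H" "w \<in> verts H" "?p ?k w \<le> ?p ?k v"
      show "?g i v \<noteq> ?g ?k w"
      proof (cases "i \<in> {j..<j + r}")
        case True
        note k_eq = next_index_inner[OF j True]
        show ?thesis
        proof (cases "?k \<in> {j..<j + r}")
          case True': True
          then show ?thesis using True k_eq ab by (auto simp: stretch_joins_def Suc_diff_le)
        next
          case False
          \<comment> \<open>The matching into the last copy is followed by the old after-matching.\<close>
          then have "Suc i = j + r" using True k_eq by auto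
          then have "odd (i - j)" using r True
            by (metis Suc_diff_le add_diff_cancel_left' atLeastLessThan_iff even_Suc)
          then have "?g i v = a" using True by (simp add: stretch_joins_def)
          moreover have "?g ?k w = g j w" using outer[OF False] inner[OF True] k_eq by simp
          ultimately show ?thesis using after vw(2) by auto
        qed
      next
        case False
        note next_c = collapse_next_index[OF j i False]
        show ?thesis
        proof (cases "?k \<in> {j..<j + r}")
          case True
          \<comment> \<open>The old before-matching is followed by the first new matching; it may wrap around if \<open>j = 1\<close>.\<close>
          then have "?k = j" using False i j by (auto simp: next_index_def split: if_splits)
          then have "?g ?k w = b" using True by (simp add: stretch_joins_def)
          moreover have "next_index s ?c = j"
            using next_c \<open>?k = j\<close> by (simp add: collapse_def)
          ultimately show ?thesis using before'[OF c _ vw(1)] outer[OF False] by metis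
        next
          case False': False
          then show ?thesis
            using outer[OF False] outer[OF False'] L(5)[OF c vw(1,2)] vw(3) next_c
              stretch_positions_outer[OF r j i False] by metis
        qed
      qed }
  qed
qed

section \<open>Extending an extensible embedding\<close>

lemma image_edges_times_cycle:
  assumes "simple_graph H"
  shows "c ` edges (times_cycle H s) =
    (\<Union>i\<in>{1..s}. (\<lambda>e. c (e \<times> {i})) ` edges H \<union>
      (\<lambda>v. c ({v} \<times> {i, next_index s i})) ` verts H)"
  unfolding edges_times_cycle[OF assms] by blast

lemma collapse_surj:
  assumes "j \<in> {1..s}" "i \<in> {1..s}"
  shows "\<exists>k\<in>{1..s + r} - {j..<j + r}. i = collapse j r k"
proof (cases "i < j")
  case True
  then show ?thesis using assms(2) by (intro bexI[of _ i]) (auto simp: collapse_def)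
next
  case False
  then show ?thesis using assms by (intro bexI[of _ "i + r"]) (auto simp: collapse_def)
qed

theorem theorem3p1:
  fixes H :: "'a graph" and t s :: nat
    and \<omega> :: "'a \<times> nat \<Rightarrow> 'a \<times> nat" and c :: "('a \<times> nat) set \<Rightarrow> nat"
  assumes "t \<ge> 2"
    and "simple_graph H" and "regular t H" and "\<not> bipartite H"
    and "s \<ge> 3"
    and "extensible H t s \<omega> c"
  shows "\<forall>r::nat. even r \<and> r > 0 \<longrightarrow>
           (\<exists>\<omega>' c'. extensible H t (s + r) \<omega>' c' \<and> extends H t s r \<omega>' c' \<omega> c)"
proof (intro allI impI)
  fix r :: nat
  assume r: "even r \<and> r > 0"
  note simple = assms(2) and s3 = assms(5)
  have fin: "finite (verts H)" using simple unfolding simple_graph_def by blast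
  have ne: "verts H \<noteq> {}"
    using assms(4) simple unfolding bipartite_def simple_graph_def by fastforce
  have mbe: "matching_book_embedding (t + 3) (times_cycle H s) \<omega> c" and eb: "en_bloc H s \<omega>"
    using assms(6) unfolding extensible_def by auto
  obtain j where seed: "seed H t s c j" using assms(6) unfolding extensible_def by blast
  then have j: "j \<in> {1..s}" unfolding seed_def by blast
  have s2: "2 \<le> s" using s3 by simp
  obtain p where ar: "arranged H s p \<omega>"
    using en_bloc_imp_arranged[OF _ eb s2] mbe unfolding matching_book_embedding_def by blast
  interpret old: block_layout H s p \<omega> by unfold_locales (rule simple s3 ar)+
  define f where "f i e = c (e \<times> {i})" for i e
  define g where "g i v = c ({v} \<times> {i, next_index s i})" for i v
  have loc: "locally_proper H s p f g"
    using old.proper_iff_locally_proper[of c] mbe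
    unfolding matching_book_embedding_def f_def g_def by blast
  have bij: "bij_betw (p i) (verts H) {..<card (verts H)}" if "i \<in> {1..s}" for i
    using ar that unfolding arranged_def by blast
  let ?h = "prev_index s j"
  have h: "?h \<in> {1..s}" "next_index s ?h = j" using prev_index_in next_prev_index j by auto
  have seed_inner: "c ` block_edges H s j = f j ` edges H"
    unfolding f_def by (rule image_block_edges[OF simple s2 j])
  have seed_after: "c ` after_matching H s j = g j ` verts H"
    unfolding g_def by (rule image_after_matching[OF simple s3 j])
  have seed_before: "c ` before_matching H s j = g ?h ` verts H"
    unfolding g_def before_matching_eq_after_matching[OF j]
    by (rule image_after_matching[OF simple s3 h(1)])
  have colors: "f i ` edges H \<subseteq> {1..t + 3}" "g i ` verts H \<subseteq> {1..t + 3}" if "i \<in> {1..s}" for i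
    using mbe that unfolding matching_book_embedding_def image_edges_times_cycle[OF simple] f_def g_def
    by blast+
  obtain x y where xy: "x \<noteq> y" "{1..t + 3} - f j ` edges H = {x, y}"
      "\<not> {x, y} \<subseteq> g ?h ` verts H" "\<not> {x, y} \<subseteq> g j ` verts H"
    using seed unfolding seed_def seed_inner seed_after seed_before by blast
  note L = locally_properD[OF loc]
  \<comment> \<open>This is where \<open>H\<close> being nonbipartite enters.\<close>
  have no_common: False
    if "z \<in> {x, y}" "z \<notin> g ?h ` verts H" "z \<notin> g j ` verts H" for z
  proof -
    have z: "z \<in> {1..t + 3}" "z \<notin> f j ` edges H" using xy(2) that(1) by blast+
    have "bipartite H"
    proof (rule bipartite_if_matchings_share_missing_color[where f = "f j" and ?g1.0 = "g ?h"
          and ?g2.0 = "g j" and D = "{1..t + 3} - {z}", OF simple assms(3) bij[OF j]])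
      show "\<And>d d'. d \<in> edges H \<Longrightarrow> d' \<in> edges H \<Longrightarrow> adjacent d d' \<or> crossing (p j) d d' \<Longrightarrow>
          f j d \<noteq> f j d'"
        using L(1)[OF j] by blast
      show "\<And>d v. d \<in> edges H \<Longrightarrow> v \<in> verts H \<Longrightarrow> spans (p j) d v \<Longrightarrow> f j d \<noteq> g ?h v"
        using L(3)[OF h(1)] unfolding h(2) by blast
      show "\<And>d v. d \<in> edges H \<Longrightarrow> v \<in> verts H \<Longrightarrow> spans (p j) d v \<Longrightarrow> f j d \<noteq> g j v"
        using L(2)[OF j] by blast
      show "\<And>v. v \<in> verts H \<Longrightarrow> g ?h v \<noteq> g j v"
        using L(5)[OF h(1)] unfolding h(2) by blast
      show "f j ` edges H \<subseteq> {1..t + 3} - {z}" using colors(1)[OF j] z by blast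
      show "g ?h ` verts H \<subseteq> {1..t + 3} - {z}" using colors(2)[OF h(1)] that by blast
      show "g j ` verts H \<subseteq> {1..t + 3} - {z}" using colors(2)[OF j] that by blast
      show "card ({1..t + 3} - {z}) = t + 2" using z by simp
    qed simp
    then show False using assms(4) by blast
  qed
  obtain a b where ab: "a \<noteq> b" "{a, b} = {x, y}" "b \<notin> g ?h ` verts H" "a \<notin> g j ` verts H"
  proof -
    obtain b where b: "b \<in> {x, y}" "b \<notin> g ?h ` verts H" using xy(3) by blast
    obtain a where a: "a \<in> {x, y}" "a \<notin> g j ` verts H" using xy(4) by blast
    have "a \<noteq> b" using no_common a b by blast
    then show thesis using that[of a b] a b by auto
  qed
  have unused: "a \<notin> f j ` edges H" "b \<notin> f j ` edges H" "a \<in> {1..t + 3}" "b \<in> {1..t + 3}"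
    using xy(2) ab(2) by blast+
  let ?s = "s + r" and ?n = "card (verts H)"
  let ?p = "stretch_positions ?n j r p" and ?f = "\<lambda>i. f (collapse j r i)"
    and ?g = "stretch_joins a b j r g"
  have s3': "3 \<le> ?s" using s3 by simp
  have j': "j \<in> {1..?s}" using j by simp
  have loc': "locally_proper H ?s ?p ?f ?g"
    using r ab unused by (intro locally_proper_stretch[OF simple loc bij j]) auto
  obtain \<omega>' where ar': "arranged H ?s ?p \<omega>'" and lay': "layout (times_cycle H ?s) \<omega>'"
  proof (rule arranged_ex)
    show "bij_betw (?p i) (verts H) {..<?n}" if "i \<in> {1..?s}" for i
      by (rule stretch_positions_bij[OF bij j that])
  qed (use fin ne s3' in auto)
  interpret new: block_layout H ?s ?p \<omega>' by unfold_locales (rule simple s3' ar')+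
  obtain c' where c': "\<And>e i. e \<noteq> {} \<Longrightarrow> c' (e \<times> {i}) = ?f i e"
    "\<And>v i. i \<in> {1..?s} \<Longrightarrow> c' ({v} \<times> {i, next_index ?s i}) = ?g i v"
    using glued_coloring[OF s3', where f = ?f and g = ?g] by blast
  have c'_edge: "c' (e \<times> {i}) = ?f i e" if "e \<in> edges H" for e i
    using c'(1) simple_graph_edge[OF simple that] by blast
  have "locally_proper H ?s ?p (\<lambda>i e. c' (e \<times> {i})) (\<lambda>i v. c' ({v} \<times> {i, next_index ?s i}))"
    by (rule locally_proper_cong[THEN iffD2, OF _ _ loc']) (use c'_edge c'(2) in blast)+
  then have proper: "\<forall>e\<in>edges (times_cycle H ?s). \<forall>e'\<in>edges (times_cycle H ?s).
      adjacent e e' \<or> conflict \<omega>' e e' \<longrightarrow> c' e \<noteq> c' e'"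
    by (rule new.proper_iff_locally_proper[THEN iffD2])
  have outer: "?g i = g (collapse j r i)" if "i \<notin> {j..<j + r}" for i
    using that unfolding stretch_joins_def by (rule if_not_P)
  have image': "c' ` edges (times_cycle H ?s) = (\<Union>i\<in>{1..?s}. ?f i ` edges H \<union> ?g i ` verts H)"
    unfolding image_edges_times_cycle[OF simple] using c'_edge c'(2) by simp
  have "c' ` edges (times_cycle H ?s) = {1..t + 3}"
  proof
    have "?g i v \<in> {1..t + 3}" if "i \<in> {1..?s}" "v \<in> verts H" for i v
    proof (cases "i \<in> {j..<j + r}")
      case True
      then show ?thesis using unused(3,4) by (simp add: stretch_joins_def)
    next
      case False
      then show ?thesis using outer colors(2)[OF collapse_in[OF j that(1)]] that(2) by fastforce
    qed
    then show "c' ` edges (times_cycle H ?s) \<subseteq> {1..t + 3}"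
      using colors(1)[OF collapse_in[OF j]] unfolding image' by blast
    show "{1..t + 3} \<subseteq> c' ` edges (times_cycle H ?s)"
    proof
      fix m assume "m \<in> {1..t + 3}"
      then have "m \<in> c ` edges (times_cycle H s)"
        using mbe unfolding matching_book_embedding_def by blast
      then obtain i where i: "i \<in> {1..s}" "m \<in> f i ` edges H \<union> g i ` verts H"
        unfolding image_edges_times_cycle[OF simple] f_def g_def by blast
      \<comment> \<open>No old color is lost: every old edge has a copy outside the new matchings.\<close>
      obtain k where k: "k \<in> {1..?s}" "k \<notin> {j..<j + r}" "i = collapse j r k"
        using collapse_surj[OF j i(1), of r] by blast
      then have "m \<in> ?f k ` edges H \<union> ?g k ` verts H" using i(2) outer[OF k(2)] by simp
      with k(1) show "m \<in> c' ` edges (times_cycle H ?s)" unfolding image' by blast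
    qed
  qed
  then have mbe': "matching_book_embedding (t + 3) (times_cycle H ?s) \<omega>' c'"
    using lay' proper unfolding matching_book_embedding_def by blast
  have eb': "en_bloc H ?s \<omega>'" by (rule arranged_imp_en_bloc[OF ar' fin ne])
  have seed': "seed H t ?s c' j"
  proof -
    have inner: "c' ` block_edges H ?s j = f j ` edges H"
      using c'_edge image_block_edges[OF simple _ j', of c'] s3' by (simp add: collapse_def)
    have "c' ` after_matching H ?s j = ?g j ` verts H"
      using c'(2)[OF j'] image_after_matching[OF simple s3' j', of c'] by simp
    also have "\<dots> \<subseteq> {b}" using r by (auto simp: stretch_joins_def)
    finally have after: "\<not> {x, y} \<subseteq> c' ` after_matching H ?s j" using ab(1,2) by auto
    let ?h' = "prev_index ?s j"
    have h': "?h' \<in> {1..?s}" by (rule prev_index_in[OF j'])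
    have "?h' \<notin> {j..<j + r}" "collapse j r ?h' = ?h"
      using j s3 r by (auto simp: prev_index_def collapse_def)
    then have "c' ` before_matching H ?s j = g ?h ` verts H"
      using c'(2)[OF h'] image_after_matching[OF simple s3' h', of c'] outer
      unfolding before_matching_eq_after_matching[OF j'] by simp
    then have "\<not> {x, y} \<subseteq> c' ` before_matching H ?s j" using xy(3) by simp
    with after show ?thesis
      using xy(1,2) j' seed unfolding seed_def inner seed_inner by blast
  qed
  have block_same: "same_block H \<omega> c i \<omega>' c' k"
    if "i \<in> {1..s}" "k \<in> {1..?s}" "?p k = p i" "collapse j r k = i" for i k
  proof -
    have pair: "{(u, m), (v, m)} = {u, v} \<times> {m}" for u v :: 'a and m :: nat by auto
    have "c ({u, v} \<times> {i}) = c' ({u, v} \<times> {k})" if "{u, v} \<in> edges H" for u v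
      unfolding c'_edge[OF that] f_def by (simp only: \<open>collapse j r k = i\<close>)
    then show ?thesis
      using arranged_block_order[OF ar that(1)] arranged_block_order[OF ar' that(2)] that(3)
      unfolding same_block_def pair by metis
  qed
  have pair: "{(v, m), (v, m')} = {v} \<times> {m, m'}" for v :: 'a and m m' :: nat by auto
  have "extends H t s r \<omega>' c' \<omega> c"
    unfolding extends_def
  proof (intro exI[of _ j] conjI ballI)
    show "seed H t s c j" by (rule seed)
    show "same_block H \<omega> c i \<omega>' c' i" if i: "i \<in> {1..j}" for i
    proof (rule block_same)
      show "?p i = p i" using i by (cases "i = j") (simp_all add: stretch_positions_def collapse_def)
    qed (use i j in \<open>simp_all add: collapse_def\<close>)
    show "same_block H \<omega> c i \<omega>' c' (i + r)" if i: "i \<in> {j..s}" for i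
    proof (rule block_same)
      show "?p (i + r) = p i"
        using i r by (cases "i = j") (simp_all add: stretch_positions_def collapse_def)
    qed (use i j in \<open>simp_all add: collapse_def\<close>)
    show "c {(v, i), (v, i + 1)} = c' {(v, i), (v, i + 1)}" if "i \<in> {1..<j}" for i v
    proof -
      have "next_index s i = i + 1" "next_index ?s i = i + 1" "i \<in> {1..?s}"
        using that j by (auto simp: next_index_def)
      then show ?thesis
        using that c'(2)[of i v] outer[of i] unfolding pair by (simp add: g_def collapse_def)
    qed
    show "c {(v, i), (v, next_index s i)} = c' {(v, i + r), (v, next_index ?s (i + r))}"
      if "i \<in> {j..s}" for i v
    proof -
      have "i + r \<in> {1..?s}" "i + r \<notin> {j..<j + r}" "collapse j r (i + r) = i"
        using that j by (auto simp: collapse_def)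
      then show ?thesis using c'(2)[of "i + r" v] outer[of "i + r"] unfolding pair by (simp add: g_def)
    qed
  qed
  with mbe' eb' seed' show "\<exists>\<omega>' c'. extensible H t ?s \<omega>' c' \<and> extends H t s r \<omega>' c' \<omega> c"
    unfolding extensible_def by blast
qed

end
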